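(* Let $P_{Y|X}$ be the transition probability matrix of a memoryless binary-input output-symmetric channel, and let $P_X^\ast=[\tfrac12\ \ \tfrac12]$. Let $R_{\mathrm{c}}$, $R_0$ and $C$ denote the critical rate, the cutoff rate, and the channel capacity, respectively, and let $$\alpha_{\mathrm{c}}=\frac{R_{\mathrm{c}}}{R_0}\in(0,1).$$ For $\alpha\in(0,1)$ let $R_\alpha=R_\alpha(P_X^\ast,P_{Y|X})$ be the unique solution $r\in(0,I(P_X^\ast,P_{Y|X}))$ to $E_{\mathrm{r}}(r,P_X^\ast)=\bigl(\frac1\alpha-1\bigr)r$. Then: a) for $\alpha\in(0,\alpha_{\mathrm{c}}]$, $R_\alpha=\alpha R_0$; b) for $\alpha\in(\alpha_{\mathrm{c}},1)$, $R_\alpha\in(R_{\mathrm{c}},C)$ is the solution to $$E_{\mathrm{sp}}(r)=\Bigl(\frac1\alpha-1\Bigr)r;$$ and $R_\alpha$ is continuous and monotonically increasing in $\alpha\in[\alpha_{\mathrm{c}},1)$ from $R_{\mathrm{c}}$ to $C$ (that is, $R_{\alpha_{\mathrm{c}}}=R_{\mathrm{c}}$ and $\lim_{\alpha\uparrow1}R_\alpha=C$).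
   Context: Logarithms have an arbitrary fixed base larger than 1. The channel has input alphabet $\{0,1\}$ and output alphabet $\mathcal{Y}$ (for non-discrete $\mathcal{Y}$, sums are replaced by integrals of densities); output-symmetric means that there is an involution $\pi$ of $\mathcal{Y}$ (measure preserving in the non-discrete case, e.g. $\pi(y)=-y$) with $P_{Y|X}(y|0)=P_{Y|X}(\pi(y)|1)$ for all $y$. Standing assumption: $I(P_X^\ast,P_{Y|X})>0$. Gallager's function is $$E_0(\rho,P_X)=-\log\sum_{y\in\mathcal{Y}}\Bigl(\sum_{x}P_X(x)P_{Y|X}^{\frac1{1+\rho}}(y|x)\Bigr)^{1+\rho}.$$ The cutoff rate is $R_0=E_0(1,P_X^\ast)$ (equal to $\log2-\log(1+\rho_{Y|X})$ with $\rho_{Y|X}=\sum_y\sqrt{P_{Y|X}(y|0)P_{Y|X}(y|1)}$); the critical rate is $R_{\mathrm{c}}=\frac{\partial}{\partial\rho}E_0(\rho,P_X^\ast)\big|_{\rho=1}$; the capacity is $C=I(P_X^\ast,P_{Y|X})$ (mutual information). The random-coding error exponent is $E_{\mathrm{r}}(R,P_X)=\max_{\rho\in[0,1]}\{E_0(\rho,P_X)-\rho R\}$ and the sphere-packing error exponent is $E_{\mathrm{sp}}(R)=\sup_{\rho\ge0}\{\max_{Q_X}E_0(\rho,Q_X)-\rho R\}$, the maximum being over all distributions $Q_X$ on $\{0,1\}$.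
   Formalization: For noiseless channels (P(y|0)P(y|1)=0 for almost all y) α_c=1, so "α_c∈(0,1)" is false there; proved instead: 0<α_c≤1, with α_c<1 for every other channel, and R_{α_c}=R_c is claimed only when α_c<1. *)

theory Defs
  imports "HOL-Probability.Probability"
begin

text \<open>
  A memoryless channel with input alphabet \<open>{0,1}\<close> (encoded as \<open>False\<close>, \<open>True\<close>) is given by its
  single-letter transition densities: \<open>W x y\<close> stands for \<open>P(y|x)\<close>, a density with respect to a
  sigma-finite reference measure \<open>M\<close> on the output alphabet \<open>space M\<close>. With the counting measure
  on a countable set, the integrals below are the sums of the discrete case; with Lebesgue
  measure they are integrals of probability density functions.
\<close>

definition binary_input_channel :: "'y measure \<Rightarrow> (bool \<Rightarrow> 'y \<Rightarrow> real) \<Rightarrow> bool" where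
  "binary_input_channel M W \<longleftrightarrow>
     sigma_finite_measure M \<and>
     (\<forall>x. W x \<in> borel_measurable M \<and>
          (\<forall>y\<in>space M. 0 \<le> W x y) \<and>
          (\<integral>\<^sup>+ y. ennreal (W x y) \<partial>M) = 1)"

definition output_symmetric :: "'y measure \<Rightarrow> (bool \<Rightarrow> 'y \<Rightarrow> real) \<Rightarrow> bool" where
  "output_symmetric M W \<longleftrightarrow>
     (\<exists>\<pi>. \<pi> \<in> measurable M M \<and> distr M M \<pi> = M \<and>
          (\<forall>y\<in>space M. \<pi> (\<pi> y) = y) \<and>
          (\<forall>y\<in>space M. W False y = W True (\<pi> y)))"

definition noiseless :: "'y measure \<Rightarrow> (bool \<Rightarrow> 'y \<Rightarrow> real) \<Rightarrow> bool" where
  "noiseless M W \<longleftrightarrow> (AE y in M. W False y = 0 \<or> W True y = 0)"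

abbreviation unif_input :: "bool pmf" where
  "unif_input \<equiv> bernoulli_pmf (1/2)"

text \<open>The parameter \<open>b\<close> is the base of the logarithms.\<close>

definition joint_law :: "'y measure \<Rightarrow> (bool \<Rightarrow> 'y \<Rightarrow> real) \<Rightarrow> bool pmf \<Rightarrow> (bool \<times> 'y) measure" where
  "joint_law M W P =
     density (count_space UNIV \<Otimes>\<^sub>M M) (\<lambda>(x, y). ennreal (pmf P x * W x y))"

definition mutual_info :: "real \<Rightarrow> 'y measure \<Rightarrow> (bool \<Rightarrow> 'y \<Rightarrow> real) \<Rightarrow> bool pmf \<Rightarrow> real" where
  "mutual_info b M W P =
     prob_space.mutual_information (joint_law M W P) b (count_space UNIV) M fst snd"

definition gallager_E0 ::
    "real \<Rightarrow> 'y measure \<Rightarrow> (bool \<Rightarrow> 'y \<Rightarrow> real) \<Rightarrow> real \<Rightarrow> bool pmf \<Rightarrow> real" where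
  "gallager_E0 b M W \<rho> P =
     - log b (\<integral>y. (\<Sum>x\<in>UNIV. pmf P x * W x y powr (1 / (1 + \<rho>))) powr (1 + \<rho>) \<partial>M)"

definition cutoff_rate :: "real \<Rightarrow> 'y measure \<Rightarrow> (bool \<Rightarrow> 'y \<Rightarrow> real) \<Rightarrow> real" where
  "cutoff_rate b M W = gallager_E0 b M W 1 unif_input"

definition critical_rate :: "real \<Rightarrow> 'y measure \<Rightarrow> (bool \<Rightarrow> 'y \<Rightarrow> real) \<Rightarrow> real" where
  "critical_rate b M W = deriv (\<lambda>\<rho>. gallager_E0 b M W \<rho> unif_input) 1"

definition capacity :: "real \<Rightarrow> 'y measure \<Rightarrow> (bool \<Rightarrow> 'y \<Rightarrow> real) \<Rightarrow> real" where
  "capacity b M W = mutual_info b M W unif_input"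

definition critical_ratio :: "real \<Rightarrow> 'y measure \<Rightarrow> (bool \<Rightarrow> 'y \<Rightarrow> real) \<Rightarrow> real" where
  "critical_ratio b M W = critical_rate b M W / cutoff_rate b M W"

text \<open>The maximum over the compact interval \<open>[0,1]\<close> of a continuous function, written as a supremum.\<close>

definition random_coding_exponent ::
    "real \<Rightarrow> 'y measure \<Rightarrow> (bool \<Rightarrow> 'y \<Rightarrow> real) \<Rightarrow> bool pmf \<Rightarrow> real \<Rightarrow> real" where
  "random_coding_exponent b M W P R = (SUP \<rho>\<in>{0..1}. gallager_E0 b M W \<rho> P - \<rho> * R)"

text \<open>
  The supremum over \<open>\<rho> \<ge> 0\<close> may be infinite at low rates, hence the extended real values. The
  inner supremum ranges over all input distributions and is attained: \<open>gallager_E0\<close> is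
  continuous in the distribution.
\<close>

definition sphere_packing_exponent ::
    "real \<Rightarrow> 'y measure \<Rightarrow> (bool \<Rightarrow> 'y \<Rightarrow> real) \<Rightarrow> real \<Rightarrow> ereal" where
  "sphere_packing_exponent b M W R =
     (SUP \<rho>\<in>{0..}. (SUP Q. ereal (gallager_E0 b M W \<rho> Q)) - ereal (\<rho> * R))"

definition is_rate_alpha ::
    "real \<Rightarrow> 'y measure \<Rightarrow> (bool \<Rightarrow> 'y \<Rightarrow> real) \<Rightarrow> bool pmf \<Rightarrow> real \<Rightarrow> real \<Rightarrow> bool" where
  "is_rate_alpha b M W P \<alpha> r \<longleftrightarrow>
     r \<in> {0<..<mutual_info b M W P} \<and>
     random_coding_exponent b M W P r = (1 / \<alpha> - 1) * r"

definition rate_alpha ::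
    "real \<Rightarrow> 'y measure \<Rightarrow> (bool \<Rightarrow> 'y \<Rightarrow> real) \<Rightarrow> bool pmf \<Rightarrow> real \<Rightarrow> real" where
  "rate_alpha b M W P \<alpha> = (THE r. is_rate_alpha b M W P \<alpha> r)"

end

theory Submission
  imports Defs
begin

text \<open>
  Let \<open>T\<close> be the posterior probability of one input under the uniform prior, regarded as a
  random variable under the output law. Then \<open>E\<^sub>0(a - 1) = - log \<integral> \<phi>\<^sub>a(T)\<close>, where
  \<open>\<phi>\<^sub>a(t) = 2 ((t\<^bsup>1/a\<^esup> + (1 - t)\<^bsup>1/a\<^esup>) / 2)\<^bsup>a\<^esup>\<close>. Gibbs' inequality, applied to the
  tilted distribution proportional to \<open>t\<^bsup>1/c\<^esup>, (1 - t)\<^bsup>1/c\<^esup>\<close> with entropy \<open>H\<close>, gives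
  \<open>ln \<phi>\<^sub>a \<ge> ln \<phi>\<^sub>c + (a - c) (H - ln 2)\<close>, and Jensen's inequality turns this into a tangent
  inequality for \<open>ln \<integral> \<phi>\<^sub>a(T)\<close>. Its slope is continuous, hence is the derivative; at \<open>a = 1\<close> it
  is minus the capacity and at \<open>a = 2\<close> minus the critical rate. Everything else follows from these
  two tangent lines, since \<open>\<alpha>\<close> is the strictly increasing function \<open>r / (E\<^sub>r(r) + r)\<close> of \<open>R\<^sub>\<alpha>\<close>.
\<close>

subsection \<open>Tilted binary distributions\<close>

definition bin_entropy :: "real \<Rightarrow> real" where
  "bin_entropy p = - (p * ln p + (1 - p) * ln (1 - p))"

lemma ln_less_minus_one:
  fixes x :: real
  assumes "0 < x" "x \<noteq> 1"
  shows "ln x < x - 1"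
  using ln_le_minus_one[OF assms(1)] ln_eq_minus_one[OF assms(1)] assms(2) by fastforce

text \<open>One summand of Gibbs' inequality: \<open>ln x \<le> x - 1\<close> at
  \<open>x = u / (p * s)\<close>, multiplied by \<open>p\<close>. With \<open>s = u + v\<close> the
  right-hand sides of the two summands cancel.\<close>

lemma gibbs_term:
  fixes p u s :: real
  assumes "0 < p" "0 < u" "0 < s"
  shows "p * ln u - p * ln p - p * ln s \<le> u / s - p"
    and "u \<noteq> p * s \<Longrightarrow> p * ln u - p * ln p - p * ln s < u / s - p"
proof -
  have e: "p * ln u - p * ln p - p * ln s = p * ln (u / (p * s))"
    using assms by (simp add: ln_div ln_mult algebra_simps)
  have e': "u / s - p = p * (u / (p * s) - 1)"
    using assms by (simp add: field_simps)
  show "p * ln u - p * ln p - p * ln s \<le> u / s - p"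
    unfolding e e' using assms by (intro mult_left_mono ln_le_minus_one) auto
  show "p * ln u - p * ln p - p * ln s < u / s - p" if "u \<noteq> p * s"
    unfolding e e' using assms that
    by (intro mult_strict_left_mono ln_less_minus_one) (auto simp: field_simps)
qed

lemma gibbs_inequality:
  fixes p u v :: real
  assumes "0 \<le> p" "p \<le> 1" "0 \<le> u" "0 \<le> v" "0 < p \<Longrightarrow> 0 < u" "p < 1 \<Longrightarrow> 0 < v"
  shows "p * ln u + (1 - p) * ln v + bin_entropy p \<le> ln (u + v)"
proof -
  consider "p = 0" | "p = 1" | "0 < p" "p < 1" using assms by linarith
  then show ?thesis
  proof cases
    case 3
    have "u / (u + v) + v / (u + v) = 1"
      using assms 3 by (simp add: add_divide_distrib[symmetric])
    then show ?thesis
      using gibbs_term(1)[of p u "u + v"] gibbs_term(1)[of "1 - p" v "u + v"] assms 3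
      by (simp add: bin_entropy_def algebra_simps)
  qed (use assms in \<open>auto simp: bin_entropy_def\<close>)
qed

lemma gibbs_inequality_strict:
  fixes p u v :: real
  assumes "0 < p" "p < 1" "0 < u" "0 < v" "u \<noteq> p * (u + v)"
  shows "p * ln u + (1 - p) * ln v + bin_entropy p < ln (u + v)"
proof -
  have "u / (u + v) + v / (u + v) = 1"
    using assms by (simp add: add_divide_distrib[symmetric])
  then show ?thesis
    using gibbs_term(2)[of p u "u + v"] gibbs_term(1)[of "1 - p" v "u + v"] assms
    by (simp add: bin_entropy_def algebra_simps)
qed

lemma bin_entropy_nonneg:
  assumes "0 \<le> p" "p \<le> 1"
  shows "0 \<le> bin_entropy p"
proof -
  have "x * ln x \<le> 0" if "0 \<le> x" "x \<le> 1" for x :: real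
    using that by (cases "x = 0") (auto simp: mult_le_0_iff)
  from this[of p] this[of "1 - p"] show ?thesis
    using assms by (simp add: bin_entropy_def)
qed

lemma bin_entropy_le:
  assumes "0 \<le> p" "p \<le> 1"
  shows "bin_entropy p \<le> ln 2"
  using gibbs_inequality[of p 1 1] assms by simp

lemma bin_entropy_less:
  assumes "0 \<le> p" "p \<le> 1" "p \<noteq> 1 / 2"
  shows "bin_entropy p < ln 2"
proof -
  consider "p = 0" | "p = 1" | "0 < p" "p < 1" using assms by linarith
  then show ?thesis
    using gibbs_inequality_strict[of p 1 1] assms by cases (auto simp: bin_entropy_def)
qed

section \<open>Power means of a binary distribution and their slopes\<close>

definition tilt_sum :: "real \<Rightarrow> real \<Rightarrow> real" where
  "tilt_sum a t = t powr (1 / a) + (1 - t) powr (1 / a)"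

definition tilt :: "real \<Rightarrow> real \<Rightarrow> real" where
  "tilt a t = t powr (1 / a) / tilt_sum a t"

text \<open>Twice the Hoelder mean of order \<open>1 / a\<close> of \<open>t\<close> and
  \<open>1 - t\<close>; the factor 2 normalises the value at \<open>a = 1\<close> to 1.\<close>

definition power_mean :: "real \<Rightarrow> real \<Rightarrow> real" where
  "power_mean a t = 2 * (tilt_sum a t / 2) powr a"

text \<open>The derivative of \<open>ln (power_mean a t)\<close> in \<open>a\<close>, for
  \<open>a > 0\<close> and \<open>t\<close> in the unit interval. In this form its sign and its
  bounds can be read off the entropy.\<close>

definition power_slope :: "real \<Rightarrow> real \<Rightarrow> real" where
  "power_slope a t = bin_entropy (tilt a t) - ln 2"

lemma tilt_sum_pos:
  assumes "0 \<le> t" "t \<le> 1"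
  shows "0 < tilt_sum a t"
  using assms by (cases "t = 0") (auto simp: tilt_sum_def intro: add_pos_nonneg)

lemma one_minus_tilt:
  assumes "0 \<le> t" "t \<le> 1"
  shows "1 - tilt a t = (1 - t) powr (1 / a) / tilt_sum a t"
  using tilt_sum_pos[OF assms, of a] by (simp add: tilt_def field_simps tilt_sum_def)

lemma tilt_range:
  assumes "0 \<le> t" "t \<le> 1"
  shows "0 \<le> tilt a t" "tilt a t \<le> 1"
proof -
  note z = tilt_sum_pos[OF assms, of a]
  show "0 \<le> tilt a t" using z by (simp add: tilt_def)
  have "0 \<le> 1 - tilt a t" unfolding one_minus_tilt[OF assms] using z by simp
  then show "tilt a t \<le> 1" by simp
qed

lemma tilt_pos_iff:
  assumes "0 \<le> t" "t \<le> 1"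
  shows "0 < tilt a t \<longleftrightarrow> 0 < t" "tilt a t < 1 \<longleftrightarrow> t < 1"
proof -
  note z = tilt_sum_pos[OF assms, of a]
  show "0 < tilt a t \<longleftrightarrow> 0 < t"
    using z assms by (auto simp: tilt_def zero_less_divide_iff)
  have "0 < 1 - tilt a t \<longleftrightarrow> t < 1"
    unfolding one_minus_tilt[OF assms] using z assms by (auto simp: zero_less_divide_iff)
  then show "tilt a t < 1 \<longleftrightarrow> t < 1" by simp
qed

lemma tilt_eq_half_iff:
  assumes "0 \<le> t" "t \<le> 1" "a \<noteq> 0"
  shows "tilt a t = 1 / 2 \<longleftrightarrow> t = 1 / 2"
proof
  assume h: "tilt a t = 1 / 2"
  note z = tilt_sum_pos[OF assms(1,2), of a]
  have "t powr (1 / a) = (1 - t) powr (1 / a)"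
    using h one_minus_tilt[OF assms(1,2), of a] z by (simp add: tilt_def)
  then have "(t powr (1 / a)) powr a = ((1 - t) powr (1 / a)) powr a" by simp
  then show "t = 1 / 2" using assms by (simp add: powr_powr)
next
  assume "t = 1 / 2"
  then have "1 - t = t" "0 < t" by simp_all
  then show "tilt a t = 1 / 2" unfolding tilt_def tilt_sum_def \<open>1 - t = t\<close> by simp
qed

lemma power_mean_pos:
  assumes "0 \<le> t" "t \<le> 1"
  shows "0 < power_mean a t"
  using tilt_sum_pos[OF assms, of a] by (simp add: power_mean_def)

lemma ln_power_mean:
  assumes "0 \<le> t" "t \<le> 1"
  shows "ln (power_mean a t) = ln 2 + a * (ln (tilt_sum a t) - ln 2)"
  using tilt_sum_pos[OF assms, of a] by (simp add: power_mean_def ln_mult ln_powr ln_div)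

lemma power_slope_bounds:
  assumes "0 \<le> t" "t \<le> 1"
  shows "- ln 2 \<le> power_slope a t" "power_slope a t \<le> 0"
  using bin_entropy_nonneg[OF tilt_range[OF assms]] bin_entropy_le[OF tilt_range[OF assms]]
  by (auto simp: power_slope_def)

lemma power_slope_neg:
  assumes "0 \<le> t" "t \<le> 1" "a \<noteq> 0" "t \<noteq> 1 / 2"
  shows "power_slope a t < 0"
  using bin_entropy_less[OF tilt_range[OF assms(1,2)], of a] tilt_eq_half_iff[OF assms(1-3)] assms(4)
  by (auto simp: power_slope_def)

text \<open>Inside the unit interval \<open>ln (tilt c t) = ln t / c - ln (tilt_sum c t)\<close>,
  and likewise for the complementary weight. At an endpoint the weight in front of
  \<open>ln 0\<close> is 0.\<close>

lemma tilt_mult_ln: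
  assumes "0 \<le> t" "t \<le> 1" "0 < c"
  shows "tilt c t * ln t + (1 - tilt c t) * ln (1 - t) =
         c * (ln (tilt_sum c t) - bin_entropy (tilt c t))"
proof -
  let ?p = "tilt c t" and ?z = "tilt_sum c t"
  note z = tilt_sum_pos[OF assms(1,2), of c]
  have 1: "?p * ln t = c * (?p * ln ?z + ?p * ln ?p)"
  proof (cases "t = 0")
    case False
    then have "ln ?p = ln t / c - ln ?z" using assms z by (simp add: tilt_def ln_div ln_powr)
    then have "ln t = c * (ln ?z + ln ?p)" using assms by simp
    then show ?thesis by (simp add: algebra_simps)
  qed (simp add: tilt_def)
  have 2: "(1 - ?p) * ln (1 - t) = c * ((1 - ?p) * ln ?z + (1 - ?p) * ln (1 - ?p))"
  proof (cases "t = 1")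
    case False
    then have "ln (1 - ?p) = ln (1 - t) / c - ln ?z"
      using assms z by (simp add: one_minus_tilt ln_div ln_powr)
    then have "ln (1 - t) = c * (ln ?z + ln (1 - ?p))" using assms by simp
    then show ?thesis by (simp add: algebra_simps)
  qed (simp add: tilt_def tilt_sum_def)
  show ?thesis unfolding 1 2 by (simp add: bin_entropy_def algebra_simps)
qed

lemma ln_powr_nonneg:
  fixes x y :: real
  assumes "0 \<le> x"
  shows "ln (x powr y) = (if x = 0 then 0 else y * ln x)"
  using assms by (auto simp: ln_powr)

text \<open>Gibbs' inequality with the weight \<open>tilt c t\<close>, which is optimal at
  \<open>a = c\<close>. Multiplied by \<open>a\<close>, its left-hand side is affine in
  \<open>a\<close>.\<close>

lemma power_mean_tangent:
  assumes "0 \<le> t" "t \<le> 1" "0 < a" "0 < c"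
  shows "ln (power_mean c t) + (a - c) * power_slope c t \<le> ln (power_mean a t)"
proof -
  let ?p = "tilt c t"
  have "?p * ln (t powr (1 / a)) + (1 - ?p) * ln ((1 - t) powr (1 / a)) + bin_entropy ?p
      \<le> ln (tilt_sum a t)"
    unfolding tilt_sum_def using assms tilt_range tilt_pos_iff by (intro gibbs_inequality) auto
  also have "?p * ln (t powr (1 / a)) + (1 - ?p) * ln ((1 - t) powr (1 / a)) =
      (?p * ln t + (1 - ?p) * ln (1 - t)) / a"
    using assms by (auto simp: ln_powr_nonneg add_divide_distrib)
  finally have "a * ((?p * ln t + (1 - ?p) * ln (1 - t)) / a + bin_entropy ?p) \<le> a * ln (tilt_sum a t)"
    using assms by (intro mult_left_mono) auto
  moreover have "a * (x / a + y) = x + a * y" for x y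
    using assms by (simp add: distrib_left)
  ultimately have "(?p * ln t + (1 - ?p) * ln (1 - t)) + a * bin_entropy ?p \<le> a * ln (tilt_sum a t)"
    by simp
  then show ?thesis
    unfolding tilt_mult_ln[OF assms(1,2,4)] ln_power_mean[OF assms(1,2)] power_slope_def
    by (simp add: algebra_simps)
qed

lemma power_mean_one [simp]: "0 \<le> t \<Longrightarrow> t \<le> 1 \<Longrightarrow> power_mean 1 t = 1"
  by (simp add: power_mean_def tilt_sum_def)

lemma tilt_one [simp]: "0 \<le> t \<Longrightarrow> t \<le> 1 \<Longrightarrow> tilt 1 t = t"
  by (simp add: tilt_def tilt_sum_def)

text \<open>The tangent at \<open>a\<close>, of slope at most 0, is evaluated at 1, where the
  logarithm vanishes. The bound later dominates the integrands.\<close>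

lemma power_mean_le_one:
  assumes "0 \<le> t" "t \<le> 1" "1 \<le> a"
  shows "power_mean a t \<le> 1"
proof -
  have "ln (power_mean a t) + (1 - a) * power_slope a t \<le> 0"
    using power_mean_tangent[of t 1 a] assms by simp
  moreover have "0 \<le> (1 - a) * power_slope a t"
    using assms power_slope_bounds[of t a] by (intro mult_nonpos_nonpos) auto
  ultimately have "ln (power_mean a t) \<le> 0" by linarith
  then show ?thesis using power_mean_pos[OF assms(1,2)] by simp
qed

text \<open>Equality in Gibbs' inequality would need \<open>t\<close> and \<open>1 - t\<close> to be
  proportional to their square roots, which inside the unit interval happens only at
  \<open>1 / 2\<close>.\<close>

lemma power_mean_two_strict:
  assumes "0 < t" "t < 1" "t \<noteq> 1 / 2"
  shows "power_slope 1 t < ln (power_mean 2 t)"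
proof -
  have ne: "sqrt t \<noteq> t * (sqrt t + sqrt (1 - t))"
  proof
    assume h: "sqrt t = t * (sqrt t + sqrt (1 - t))"
    have "sqrt t * (1 - t) = t * sqrt (1 - t)" using h by (simp add: algebra_simps)
    then have "(sqrt t * (1 - t))\<^sup>2 = (t * sqrt (1 - t))\<^sup>2" by simp
    then have "t * (1 - t)\<^sup>2 = t\<^sup>2 * (1 - t)"
      using assms by (simp add: power_mult_distrib)
    then have "t * (1 - t) * (1 - 2 * t) = 0" by algebra
    then show False using assms by simp
  qed
  have "t * ln (sqrt t) + (1 - t) * ln (sqrt (1 - t)) + bin_entropy t < ln (sqrt t + sqrt (1 - t))"
    using assms ne by (intro gibbs_inequality_strict) auto
  moreover have "tilt_sum 2 t = sqrt t + sqrt (1 - t)"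
    using assms by (simp add: tilt_sum_def powr_half_sqrt)
  ultimately show ?thesis
    using assms by (simp add: power_slope_def ln_power_mean bin_entropy_def ln_sqrt field_simps)
qed

lemma power_mean_two_half: "power_mean 2 (1 / 2) = 1"
  by (simp add: power_mean_def tilt_sum_def powr_half_sqrt real_sqrt_divide power_divide)

lemma isCont_power_mean:
  assumes "0 \<le> t" "t \<le> 1" "0 < a"
  shows "isCont (\<lambda>a. power_mean a t) a" "isCont (\<lambda>a. power_slope a t) a"
proof -
  have z: "isCont (\<lambda>a. tilt_sum a t) a"
    using assms unfolding tilt_sum_def
    by (cases "t = 0"; cases "t = 1") (auto intro!: continuous_intros)
  show "isCont (\<lambda>a. power_mean a t) a"
    unfolding power_mean_def using z tilt_sum_pos[OF assms(1,2), of a]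
    by (auto intro!: continuous_intros)
  \<comment> \<open>At the endpoints the tilted weight is constant in \<open>a\<close>; elsewhere it
    stays strictly between 0 and 1, where both logarithms are continuous.\<close>
  consider "t = 0" | "t = 1" | "0 < t" "t < 1" using assms by linarith
  then show "isCont (\<lambda>a. power_slope a t) a"
  proof cases
    case 3
    have p: "isCont (\<lambda>a. tilt a t) a"
      unfolding tilt_def using z tilt_sum_pos[OF assms(1,2), of a] assms 3
      by (auto intro!: continuous_intros)
    then show ?thesis
      unfolding power_slope_def bin_entropy_def
      using tilt_pos_iff[OF assms(1,2), of a] 3 by (auto intro!: continuous_intros)
  qed (auto simp: power_slope_def tilt_def tilt_sum_def)
qed

subsection \<open>Exponents determined by two tangent lines\<close>

text \<open>The supporting lines at \<open>x\<close> and at \<open>y\<close> squeeze the difference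
  quotient between \<open>S x\<close> and \<open>S y\<close>. Working within \<open>A\<close>
  includes one-sided derivatives at boundary points.\<close>

lemma has_field_derivative_tangent:
  fixes f S :: "real \<Rightarrow> real"
  assumes tangent: "\<And>x y. x \<in> A \<Longrightarrow> y \<in> A \<Longrightarrow> f x + (y - x) * S x \<le> f y"
    and x: "x \<in> A" and cont: "continuous (at x within A) S"
  shows "(f has_field_derivative S x) (at x within A)"
  unfolding has_field_derivative_iff
proof (rule LIM_zero_cancel, rule Lim_null_comparison)
  show "((\<lambda>y. norm (S y - S x)) \<longlongrightarrow> 0) (at x within A)"
    using cont by (intro tendsto_norm_zero LIM_zero) (simp add: continuous_within)
  have "norm ((f y - f x) / (y - x) - S x) \<le> norm (S y - S x)" if y: "y \<in> A" "y \<noteq> x" for y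
  proof -
    have 1: "(y - x) * S x \<le> f y - f x" "f y - f x \<le> (y - x) * S y"
      using tangent[OF x y(1)] tangent[OF y(1) x] by (auto simp: algebra_simps)
    show ?thesis
    proof (cases "x < y")
      case True
      then have "S x \<le> (f y - f x) / (y - x)" "(f y - f x) / (y - x) \<le> S y"
        using 1 by (auto simp: field_simps)
      then show ?thesis by simp
    next
      case False
      then have "(f y - f x) / (y - x) \<le> S x" "S y \<le> (f y - f x) / (y - x)"
        using 1 y(2) by (auto simp: field_simps)
      then show ?thesis by simp
    qed
  qed
  then show "eventually (\<lambda>y. norm ((f y - f x) / (y - x) - S x) \<le> norm (S y - S x)) (at x within A)"
    by (auto simp: eventually_at_filter)
qed

text \<open>The properties of Gallager's function from which the exponents are determined: upper
  tangents at 0 and 1 and the right derivative at 0. \<open>C\<close> plays the capacity,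
  \<open>E 1\<close> the cutoff rate and \<open>Rc\<close> the critical rate.\<close>

locale exponent_function =
  fixes E :: "real \<Rightarrow> real" and C Rc :: real
  assumes tangent_zero: "0 \<le> \<rho> \<Longrightarrow> E \<rho> \<le> C * \<rho>"
    and tangent_one: "0 \<le> \<rho> \<Longrightarrow> E \<rho> \<le> E 1 + Rc * (\<rho> - 1)"
    and E_zero: "E 0 = 0"
    and deriv_zero: "(E has_field_derivative C) (at 0 within {0..})"
    and Rc_pos: "0 < Rc"
begin

definition expo :: "real \<Rightarrow> real" where
  "expo r = (SUP \<rho>\<in>{0..1}. E \<rho> - \<rho> * r)"

lemma Rc_le: "Rc \<le> E 1"
  using tangent_one[of 0] E_zero by simp

lemma C_ge: "E 1 \<le> C"
  using tangent_zero[of 1] by simp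

lemma C_pos: "0 < C" and E_one_pos: "0 < E 1"
  using Rc_pos Rc_le C_ge by auto

text \<open>A real supremum is informative only over a bounded set; the tangent at 0 supplies the
  bound.\<close>

lemma bdd_above_expo: "bdd_above ((\<lambda>\<rho>. E \<rho> - \<rho> * r) ` {0..1})"
proof (rule bdd_aboveI2)
  fix \<rho> :: real assume \<rho>: "\<rho> \<in> {0..1}"
  have "E \<rho> - \<rho> * r \<le> \<rho> * (C - r)" using tangent_zero[of \<rho>] \<rho> by (simp add: algebra_simps)
  also have "\<dots> \<le> \<rho> * \<bar>C - r\<bar>" using \<rho> by (intro mult_left_mono) auto
  also have "\<dots> \<le> 1 * \<bar>C - r\<bar>" using \<rho> by (intro mult_right_mono) auto
  finally show "E \<rho> - \<rho> * r \<le> 1 * \<bar>C - r\<bar>" .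
qed

lemma expo_ge: "\<rho> \<in> {0..1} \<Longrightarrow> E \<rho> - \<rho> * r \<le> expo r"
  unfolding expo_def by (rule cSUP_upper[OF _ bdd_above_expo])

lemma expo_le: "(\<And>\<rho>. \<rho> \<in> {0..1} \<Longrightarrow> E \<rho> - \<rho> * r \<le> c) \<Longrightarrow> expo r \<le> c"
  unfolding expo_def by (rule cSUP_least) auto

lemma expo_antimono:
  assumes "r \<le> r'"
  shows "expo r' \<le> expo r"
proof (rule expo_le)
  fix \<rho> :: real assume \<rho>: "\<rho> \<in> {0..1}"
  have "\<rho> * r \<le> \<rho> * r'" using \<rho> assms by (intro mult_left_mono) auto
  then show "E \<rho> - \<rho> * r' \<le> expo r" using expo_ge[OF \<rho>, of r] by linarith
qed

text \<open>All affine functions of \<open>r\<close> under the supremum have slope between -1 and 0.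
  Together with antitonicity this makes \<open>expo\<close> 1-Lipschitz.\<close>

lemma expo_diff_le:
  assumes "r \<le> r'"
  shows "expo r \<le> expo r' + (r' - r)"
proof (rule expo_le)
  fix \<rho> :: real assume \<rho>: "\<rho> \<in> {0..1}"
  have "\<rho> * (r' - r) \<le> 1 * (r' - r)" using \<rho> assms by (intro mult_right_mono) auto
  then show "E \<rho> - \<rho> * r \<le> expo r' + (r' - r)"
    using expo_ge[OF \<rho>, of r'] by (simp add: algebra_simps)
qed

lemma continuous_on_expo: "continuous_on A expo"
proof (rule continuous_on_subset[OF lipschitz_on_continuous_on])
  show "1-lipschitz_on UNIV expo"
  proof (rule lipschitz_onI)
    fix x y show "dist (expo x) (expo y) \<le> 1 * dist x y"
      using expo_antimono[of x y] expo_antimono[of y x] expo_diff_le[of x y] expo_diff_le[of y x]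
      by (cases "x \<le> y") (auto simp: dist_real_def)
  qed simp
qed simp

lemma expo_capacity: "expo C = 0"
proof (rule antisym)
  show "expo C \<le> 0" using tangent_zero by (intro expo_le) (simp add: mult.commute)
  show "0 \<le> expo C" using expo_ge[of 0 C] E_zero by simp
qed

text \<open>The quotient \<open>E \<rho> / \<rho>\<close> tends to \<open>C\<close> as
  \<open>\<rho>\<close> decreases to 0, so it exceeds \<open>r\<close> for small positive
  \<open>\<rho>\<close>.\<close>

lemma exists_above:
  assumes "r < C"
  shows "\<exists>\<rho>. 0 < \<rho> \<and> \<rho> \<le> 1 \<and> \<rho> * r < E \<rho>"
proof -
  have "((\<lambda>\<rho>. E \<rho> / \<rho>) \<longlongrightarrow> C) (at 0 within {0..})"
    using deriv_zero E_zero by (simp add: has_field_derivative_iff)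
  then have "eventually (\<lambda>\<rho>. r < E \<rho> / \<rho>) (at 0 within {0..})"
    using assms by (rule order_tendstoD)
  then obtain d where d: "d > 0" "\<And>\<rho>. 0 < \<rho> \<Longrightarrow> \<rho> < d \<Longrightarrow> r < E \<rho> / \<rho>"
    by (auto simp: eventually_at dist_real_def)
  have "r < E (min 1 (d / 2)) / min 1 (d / 2)"
    using d(1) by (intro d(2)) auto
  then show ?thesis
    using d(1) by (intro exI[of _ "min 1 (d / 2)"]) (auto simp: field_simps)
qed

lemma expo_pos:
  assumes "r < C"
  shows "0 < expo r"
proof -
  obtain \<rho> where "0 < \<rho>" "\<rho> \<le> 1" "\<rho> * r < E \<rho>" using exists_above[OF assms] by blast
  then show ?thesis using expo_ge[of \<rho> r] by simp
qed

text \<open>Some point of the curve before 1 lies strictly above the chord from 0 to 1. The tangent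
  at 1 passes over that point, so it is less steep than the chord.\<close>

lemma Rc_less:
  assumes "E 1 < C"
  shows "Rc < E 1"
proof -
  obtain \<rho> where \<rho>: "0 < \<rho>" "\<rho> \<le> 1" "\<rho> * E 1 < E \<rho>" using exists_above[OF assms] by blast
  then have "\<rho> < 1" by (cases "\<rho> = 1") auto
  have "Rc * (1 - \<rho>) < E 1 * (1 - \<rho>)"
    using \<rho> tangent_one[of \<rho>] by (simp add: algebra_simps)
  then show ?thesis using \<open>\<rho> < 1\<close> by simp
qed

section \<open>The rate as crossing point of the exponent and a line\<close>

definition is_rate :: "real \<Rightarrow> real \<Rightarrow> bool" where
  "is_rate \<alpha> r \<longleftrightarrow> r \<in> {0<..<C} \<and> expo r = (1 / \<alpha> - 1) * r"

definition rate :: "real \<Rightarrow> real" where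
  "rate \<alpha> = (THE r. is_rate \<alpha> r)"

text \<open>The antitone exponent is cut by a line of slope \<open>1 / \<alpha> - 1\<close>, which
  flattens as \<open>\<alpha>\<close> grows, so the crossing moves to the right. The case
  \<open>\<alpha> = \<beta>\<close> gives uniqueness.\<close>

lemma is_rate_mono:
  assumes "is_rate \<alpha> r" "is_rate \<beta> s" "\<alpha> \<le> \<beta>" "0 < \<alpha>" "\<beta> < 1"
  shows "r \<le> s" "\<alpha> < \<beta> \<Longrightarrow> r < s"
proof -
  have k: "1 / \<beta> - 1 \<le> 1 / \<alpha> - 1" "0 < 1 / \<beta> - 1" using assms by (auto simp: field_simps)
  have rs: "0 < r" "0 < s" using assms by (auto simp: is_rate_def)
  show le: "r \<le> s"
  proof (rule ccontr)
    assume "\<not> r \<le> s"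
    then have "(1 / \<beta> - 1) * s < (1 / \<beta> - 1) * r" using k by simp
    also have "\<dots> \<le> (1 / \<alpha> - 1) * r" using k rs by (intro mult_right_mono) auto
    finally show False
      using expo_antimono[of s r] \<open>\<not> r \<le> s\<close> assms by (simp add: is_rate_def)
  qed
  show "r < s" if "\<alpha> < \<beta>"
  proof (rule ccontr)
    assume "\<not> r < s"
    then have "r = s" using le by simp
    then have "1 / \<alpha> = 1 / \<beta>" using assms rs by (simp add: is_rate_def)
    then show False using that assms by (simp add: field_simps)
  qed
qed

lemma ex1_rate:
  assumes "\<alpha> \<in> {0<..<1}"
  shows "\<exists>!r. is_rate \<alpha> r"
proof -
  have k: "0 < 1 / \<alpha> - 1" using assms by (auto simp: field_simps)
  \<comment> \<open>The difference of line and exponent is negative at 0 and positive at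
    \<open>C\<close>, where the exponent vanishes.\<close>
  have "\<exists>r\<ge>0. r \<le> C \<and> (1 / \<alpha> - 1) * r - expo r = 0"
    using k C_pos expo_capacity expo_pos[of 0]
    by (intro IVT' continuous_intros continuous_on_expo) auto
  then obtain r where r: "0 \<le> r" "r \<le> C" "(1 / \<alpha> - 1) * r = expo r" by auto
  have "r \<noteq> 0" using r(3) expo_pos[of 0] C_pos by auto
  moreover have "r \<noteq> C" using r(3) expo_capacity C_pos k by auto
  ultimately have "is_rate \<alpha> r" using r by (auto simp: is_rate_def)
  then show ?thesis using is_rate_mono(1)[of \<alpha> _ \<alpha>] assms by (auto intro!: antisym)
qed

lemma is_rate_rate: "\<alpha> \<in> {0<..<1} \<Longrightarrow> is_rate \<alpha> (rate \<alpha>)"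
  unfolding rate_def by (rule theI'[OF ex1_rate])

lemma rate_eqI: "\<alpha> \<in> {0<..<1} \<Longrightarrow> is_rate \<alpha> r \<Longrightarrow> rate \<alpha> = r"
  using ex1_rate is_rate_rate by blast

lemma rate_range: "\<alpha> \<in> {0<..<1} \<Longrightarrow> rate \<alpha> \<in> {0<..<C}"
  using is_rate_rate by (simp add: is_rate_def)

lemma strict_mono_on_rate: "strict_mono_on {0<..<1} rate"
proof (rule strict_mono_onI)
  fix \<alpha> \<beta> :: real assume "\<alpha> \<in> {0<..<1}" "\<beta> \<in> {0<..<1}" "\<alpha> < \<beta>"
  then show "rate \<alpha> < rate \<beta>"
    using is_rate_mono(2)[OF is_rate_rate is_rate_rate, of \<alpha> \<beta>] by simp
qed

lemma rate_surj:
  assumes "r \<in> {0<..<C}"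
  shows "\<exists>\<alpha>\<in>{0<..<1}. rate \<alpha> = r"
proof -
  have e: "0 < expo r" using expo_pos assms by simp
  \<comment> \<open>This ratio is the equation of \<open>is_rate\<close> solved for
    \<open>\<alpha>\<close>.\<close>
  have "r / (expo r + r) \<in> {0<..<1}" using e assms by (simp add: field_simps)
  moreover have "is_rate (r / (expo r + r)) r" using e assms by (simp add: is_rate_def field_simps)
  ultimately show ?thesis using rate_eqI by blast
qed

lemma rate_image: "rate ` {0<..<1} = {0<..<C}"
proof
  show "rate ` {0<..<1} \<subseteq> {0<..<C}" using rate_range by blast
  show "{0<..<C} \<subseteq> rate ` {0<..<1}" using rate_surj by blast
qed

text \<open>A monotone function whose image is an open interval cannot jump.\<close>

lemma continuous_on_rate: "continuous_on {0<..<1} rate"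
  using strict_mono_on_leD[OF strict_mono_on_rate]
  by (intro continuous_onI_mono) (auto simp: rate_image)

lemma rate_tendsto: "(rate \<longlongrightarrow> C) (at_left 1)"
proof (rule order_tendstoI)
  fix c assume "c < C"
  \<comment> \<open>Raising \<open>c\<close> to at least \<open>C / 2\<close> makes it positive,
    hence a value of \<open>rate\<close>.\<close>
  define c' where "c' = max c (C / 2)"
  have "c' \<in> {0<..<C}" using \<open>c < C\<close> C_pos by (auto simp: c'_def)
  then obtain \<beta> where \<beta>: "\<beta> \<in> {0<..<1}" "rate \<beta> = c'" using rate_surj by blast
  have "c < rate \<alpha>" if "\<beta> < \<alpha>" "\<alpha> < 1" for \<alpha>
    using strict_mono_onD[OF strict_mono_on_rate, of \<beta> \<alpha>] that \<beta> by (auto simp: c'_def)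
  then show "eventually (\<lambda>\<alpha>. c < rate \<alpha>) (at_left 1)"
    using \<beta>(1) by (auto simp: eventually_at_left[of 0] intro!: exI[of _ \<beta>])
next
  fix c assume "C < c"
  then have "rate \<alpha> < c" if "0 < \<alpha>" "\<alpha> < 1" for \<alpha>
    using rate_range[of \<alpha>] that by simp
  then show "eventually (\<lambda>\<alpha>. rate \<alpha> < c) (at_left 1)"
    by (auto simp: eventually_at_left[of 0] intro!: exI[of _ 0])
qed

section \<open>Behaviour on either side of the critical rate\<close>

lemma expo_below_critical:
  assumes "r \<le> Rc"
  shows "expo r = E 1 - r"
proof (rule antisym)
  show "expo r \<le> E 1 - r"
  proof (rule expo_le)
    fix \<rho> :: real assume \<rho>: "\<rho> \<in> {0..1}"
    \<comment> \<open>Since \<open>r\<close> is at most the slope of the tangent at 1, the objective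
      is largest at \<open>\<rho> = 1\<close>.\<close>
    have "(1 - \<rho>) * r \<le> (1 - \<rho>) * Rc" using \<rho> assms by (intro mult_left_mono) auto
    then show "E \<rho> - \<rho> * r \<le> E 1 - r" using tangent_one[of \<rho>] \<rho> by (simp add: algebra_simps)
  qed
  show "E 1 - r \<le> expo r" using expo_ge[of 1 r] by simp
qed

text \<open>On the straight part the equation reads \<open>E 1 - r = (1 / \<alpha> - 1) * r\<close>,
  so \<open>r = \<alpha> * E 1\<close>; the bound on \<open>\<alpha>\<close> says that this
  \<open>r\<close> does not leave the straight part.\<close>

lemma rate_below_critical:
  assumes "\<alpha> \<in> {0<..<1}" "\<alpha> \<le> Rc / E 1"
  shows "rate \<alpha> = \<alpha> * E 1"
proof (rule rate_eqI[OF assms(1)])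
  have "\<alpha> * E 1 \<le> Rc" using assms E_one_pos by (simp add: field_simps)
  moreover have "\<alpha> * E 1 < 1 * E 1" using assms E_one_pos by (intro mult_strict_right_mono) auto
  then have "\<alpha> * E 1 < C" using C_ge by linarith
  ultimately show "is_rate \<alpha> (\<alpha> * E 1)"
    using assms E_one_pos C_ge by (auto simp: is_rate_def expo_below_critical field_simps)
qed

lemma rate_above_critical:
  assumes "\<alpha> \<in> {0<..<1}" "Rc / E 1 < \<alpha>"
  shows "Rc < rate \<alpha>"
proof -
  have "0 < Rc / E 1" using Rc_pos E_one_pos by simp
  \<comment> \<open>The critical ratio lies below \<open>\<alpha>\<close>, hence below 1, so
    \<open>rate\<close> can be evaluated there; its value is \<open>Rc\<close>.\<close>
  moreover have "Rc / E 1 < 1" using assms by (simp only: greaterThanLessThan_iff) linarith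
  ultimately have "Rc / E 1 \<in> {0<..<1}" by (simp only: greaterThanLessThan_iff)
  then show ?thesis
    using strict_mono_onD[OF strict_mono_on_rate _ assms(1,2)] rate_below_critical[of "Rc / E 1"]
      E_one_pos by auto
qed

text \<open>From \<open>Rc\<close> on, the tangent at 1 shows that no \<open>\<rho> > 1\<close> does
  better than \<open>\<rho> = 1\<close>, so the wider range leaves the supremum unchanged.\<close>

lemma SUP_eq_expo:
  assumes "Rc \<le> r"
  shows "(SUP \<rho>\<in>{0..}. ereal (E \<rho> - \<rho> * r)) = ereal (expo r)"
proof (rule antisym)
  show "(SUP \<rho>\<in>{0..}. ereal (E \<rho> - \<rho> * r)) \<le> ereal (expo r)"
  proof (rule SUP_least)
    fix \<rho> :: real assume \<rho>: "\<rho> \<in> {0..}"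
    have "E \<rho> - \<rho> * r \<le> expo r"
    proof (cases "\<rho> \<le> 1")
      case False
      have "(\<rho> - 1) * Rc \<le> (\<rho> - 1) * r" using False assms by (intro mult_left_mono) auto
      then show ?thesis
        using tangent_one[of \<rho>] \<rho> expo_ge[of 1 r] by (simp add: algebra_simps)
    qed (use \<rho> expo_ge in simp)
    then show "ereal (E \<rho> - \<rho> * r) \<le> ereal (expo r)" by simp
  qed
  show "ereal (expo r) \<le> (SUP \<rho>\<in>{0..}. ereal (E \<rho> - \<rho> * r))"
  proof (rule ereal_le_real)
    fix c assume c: "(SUP \<rho>\<in>{0..}. ereal (E \<rho> - \<rho> * r)) \<le> ereal c"
    have "E \<rho> - \<rho> * r \<le> c" if "\<rho> \<in> {0..1}" for \<rho>
    proof -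
      have "ereal (E \<rho> - \<rho> * r) \<le> (SUP \<rho>\<in>{0..}. ereal (E \<rho> - \<rho> * r))"
        using that by (intro SUP_upper) auto
      then have "ereal (E \<rho> - \<rho> * r) \<le> ereal c" using c by (rule order_trans)
      then show ?thesis by simp
    qed
    then have "expo r \<le> c" by (rule expo_le)
    then show "ereal (expo r) \<le> ereal c" by simp
  qed
qed

text \<open>The rate exceeds \<open>Rc\<close>, where the supremum equals \<open>expo\<close>, so it
  is a solution. It is the only real one because the supremum is antitone in \<open>r\<close> while
  the line increases strictly.\<close>

lemma SUP_eq_iff_rate:
  assumes "\<alpha> \<in> {0<..<1}" "Rc / E 1 < \<alpha>"
  shows "(SUP \<rho>\<in>{0..}. ereal (E \<rho> - \<rho> * r)) = ereal ((1 / \<alpha> - 1) * r) \<longleftrightarrow> r = rate \<alpha>"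
    (is "?E r = _ \<longleftrightarrow> _")
proof
  have k: "0 < 1 / \<alpha> - 1" using assms by (auto simp: field_simps)
  have root: "?E (rate \<alpha>) = ereal ((1 / \<alpha> - 1) * rate \<alpha>)"
    using SUP_eq_expo[of "rate \<alpha>"] rate_above_critical[OF assms] is_rate_rate[OF assms(1)]
    by (simp add: is_rate_def)
  then show "?E r = ereal ((1 / \<alpha> - 1) * r)" if "r = rate \<alpha>" using that by simp
  have E_mono: "?E s' \<le> ?E s" if "s \<le> s'" for s s'
    using that by (intro SUP_subset_mono) (auto intro!: mult_left_mono)
  assume h: "?E r = ereal ((1 / \<alpha> - 1) * r)"
  have "ereal (E 1 - 1 * r) \<le> ?E r" by (intro SUP_upper) auto
  then have "E 1 \<le> r * (1 / \<alpha>)" using h by (simp add: algebra_simps)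
  then have "0 < r" using E_one_pos assms by (smt (verit) greaterThanLessThan_iff zero_less_divide_1_iff zero_less_mult_pos2)
  show "r = rate \<alpha>"
  proof (rule linorder_cases)
    assume "r < rate \<alpha>"
    then have "(1 / \<alpha> - 1) * r < (1 / \<alpha> - 1) * rate \<alpha>" using k by simp
    moreover have "ereal ((1 / \<alpha> - 1) * rate \<alpha>) \<le> ereal ((1 / \<alpha> - 1) * r)"
      unfolding h[symmetric] root[symmetric] using \<open>r < rate \<alpha>\<close> by (intro E_mono) simp
    ultimately show ?thesis by simp
  next
    assume "rate \<alpha> < r"
    then have "(1 / \<alpha> - 1) * rate \<alpha> < (1 / \<alpha> - 1) * r" using k by simp
    moreover have "ereal ((1 / \<alpha> - 1) * r) \<le> ereal ((1 / \<alpha> - 1) * rate \<alpha>)"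
      unfolding h[symmetric] root[symmetric] using \<open>rate \<alpha> < r\<close> by (intro E_mono) simp
    ultimately show ?thesis by simp
  qed
qed

end

subsection \<open>Averaging over the posterior\<close>

lemma measurable_power_mean [measurable]: "power_mean a \<in> borel_measurable borel"
  unfolding power_mean_def tilt_sum_def by measurable

lemma measurable_power_slope [measurable]: "power_slope a \<in> borel_measurable borel"
  unfolding power_slope_def bin_entropy_def tilt_def tilt_sum_def by measurable

locale posterior = prob_space N for N :: "'a measure" +
  fixes T :: "'a \<Rightarrow> real"
  assumes T_measurable [measurable]: "T \<in> borel_measurable N"
    and T_range: "y \<in> space N \<Longrightarrow> 0 \<le> T y" "y \<in> space N \<Longrightarrow> T y \<le> 1"
begin

definition mean :: "real \<Rightarrow> real" where
  "mean a = (\<integral>y. power_mean a (T y) \<partial>N)"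

text \<open>The derivative of \<open>ln (mean a)\<close>, obtained formally by differentiating under
  the integral: the average of \<open>power_slope\<close> with weight
  \<open>power_mean\<close>.\<close>

definition mean_slope :: "real \<Rightarrow> real" where
  "mean_slope a = (\<integral>y. power_mean a (T y) * power_slope a (T y) \<partial>N) / mean a"

lemma power_mean_T_pos: "y \<in> space N \<Longrightarrow> 0 < power_mean a (T y)"
  using T_range by (intro power_mean_pos) auto

lemma weighted_slope_bound:
  assumes "1 \<le> a" "y \<in> space N"
  shows "\<bar>power_mean a (T y) * power_slope a (T y)\<bar> \<le> 1"
proof -
  have "\<bar>power_mean a (T y) * power_slope a (T y)\<bar> \<le> 1 * ln 2"
    using power_mean_T_pos[OF assms(2), of a] power_mean_le_one[of "T y" a] power_slope_bounds[of "T y" a]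
      T_range[OF assms(2)] assms unfolding abs_mult by (intro mult_mono) auto
  also have "\<dots> \<le> 1" using ln_le_minus_one[of 2] by simp
  finally show ?thesis .
qed

lemma integrable_power_mean: "1 \<le> a \<Longrightarrow> integrable N (\<lambda>y. power_mean a (T y))"
  using power_mean_le_one T_range power_mean_T_pos[THEN less_imp_le]
  by (intro integrable_const_bound[where B = 1]) auto

lemma integrable_weighted_slope:
  "1 \<le> a \<Longrightarrow> integrable N (\<lambda>y. power_mean a (T y) * power_slope a (T y))"
  using weighted_slope_bound by (intro integrable_const_bound[where B = 1]) auto

lemma integrable_power_slope: "integrable N (\<lambda>y. power_slope a (T y))"
  using power_slope_bounds T_range
  by (intro integrable_const_bound[where B = "ln 2"]) (auto simp: abs_le_iff minus_le_iff)

lemma mean_pos: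
  assumes "1 \<le> a"
  shows "0 < mean a"
proof -
  have "mean a \<noteq> 0"
  proof
    assume "mean a = 0"
    then have "AE y in N. power_mean a (T y) = 0"
      unfolding mean_def using integrable_power_mean[OF assms] power_mean_T_pos
      by (subst (asm) integral_nonneg_eq_0_iff_AE) (auto intro: less_imp_le)
    then have "AE y in N. False"
      using AE_space by eventually_elim (use power_mean_T_pos[of _ a] in fastforce)
    then show False by simp
  qed
  moreover have "0 \<le> mean a"
    unfolding mean_def using power_mean_T_pos by (intro Bochner_Integration.integral_nonneg) (auto intro: less_imp_le)
  ultimately show ?thesis by simp
qed

lemma mean_one [simp]: "mean 1 = 1"
proof -
  have "mean 1 = (\<integral>y. 1 \<partial>N)"
    unfolding mean_def using T_range by (intro Bochner_Integration.integral_cong) auto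
  then show ?thesis by (simp add: prob_space)
qed

lemma mean_slope_one: "mean_slope 1 = (\<integral>y. power_slope 1 (T y) \<partial>N)"
  unfolding mean_slope_def using T_range
  by (simp, intro Bochner_Integration.integral_cong) auto

lemma mean_slope_nonpos:
  assumes "1 \<le> a"
  shows "mean_slope a \<le> 0"
proof -
  have "(\<integral>y. power_mean a (T y) * power_slope a (T y) \<partial>N) \<le> (\<integral>y. 0 \<partial>N)"
    using integrable_weighted_slope[OF assms] power_mean_T_pos power_slope_bounds(2) T_range
    by (intro integral_mono) (auto simp: mult_le_0_iff less_imp_le)
  then show ?thesis using mean_pos[OF assms] by (simp add: mean_slope_def divide_nonpos_pos)
qed

text \<open>Jensen's inequality for \<open>exp\<close> under the weight \<open>power_mean c\<close>,
  combined with the pointwise tangent inequality.\<close>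

lemma mean_tangent:
  assumes "1 \<le> a" "1 \<le> c"
  shows "ln (mean c) + (a - c) * mean_slope c \<le> ln (mean a)"
proof -
  define m where "m = (a - c) * mean_slope c"
  \<comment> \<open>This expands \<open>power_mean c (T y) * exp m * (1 + x - m)\<close>, the lower
    bound from the tangent of \<open>exp\<close> at \<open>m\<close>, where
    \<open>x = (a - c) * power_slope c (T y)\<close>. As \<open>m\<close> is the weighted mean of
    \<open>x\<close>, the integral collapses to \<open>exp m * mean c\<close>.\<close>
  let ?g = "\<lambda>y. exp m * ((1 - m) * power_mean c (T y) +
    (a - c) * (power_mean c (T y) * power_slope c (T y)))"
  have "(\<integral>y. ?g y \<partial>N) \<le> mean a"
    unfolding mean_def
  proof (rule integral_mono)
    show "integrable N ?g"
      using integrable_power_mean[OF assms(2)] integrable_weighted_slope[OF assms(2)] by simp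
    fix y assume y: "y \<in> space N"
    note t = T_range[OF y] and p = power_mean_T_pos[OF y]
    let ?x = "(a - c) * power_slope c (T y)"
    have "1 + (?x - m) \<le> exp (?x - m)" by (rule exp_ge_add_one_self)
    then have "exp m * (1 + (?x - m)) \<le> exp m * exp (?x - m)" by simp
    also have "\<dots> = exp ?x" by (simp add: exp_add[symmetric])
    finally have "power_mean c (T y) * (exp m * (1 + (?x - m))) \<le> power_mean c (T y) * exp ?x"
      using p[of c] by simp
    moreover have "power_mean c (T y) * exp ?x \<le> power_mean a (T y)"
    proof -
      have "exp (ln (power_mean c (T y)) + ?x) \<le> exp (ln (power_mean a (T y)))"
        using power_mean_tangent[OF t, of a c] assms by simp
      then show ?thesis using p by (simp add: exp_add)
    qed
    ultimately show "?g y \<le> power_mean a (T y)" by (simp add: algebra_simps)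
  qed (use integrable_power_mean assms in auto)
  also have "(\<integral>y. ?g y \<partial>N) = exp m * ((1 - m) * mean c + (a - c) * (mean_slope c * mean c))"
    using integrable_power_mean[OF assms(2)] integrable_weighted_slope[OF assms(2)] mean_pos[OF assms(2)]
    by (simp add: mean_def[symmetric] mean_slope_def)
  also have "\<dots> = exp m * mean c" by (simp add: m_def algebra_simps)
  finally have "ln (exp m * mean c) \<le> ln (mean a)"
    using mean_pos assms by simp
  then show ?thesis using mean_pos[OF assms(2)] by (simp add: ln_mult m_def)
qed

lemma continuous_mean_slope:
  assumes "1 \<le> a"
  shows "continuous (at a within {1..}) mean_slope"
proof -
  \<comment> \<open>Dominated convergence along sequences with the constant 1, stated once for
    numerator and denominator of \<open>mean_slope\<close>.\<close>
  have lim: "((\<lambda>x. \<integral>y. f x (T y) \<partial>N) \<longlongrightarrow> (\<integral>y. f a (T y) \<partial>N)) (at a within {1..})"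
    if [measurable]: "\<And>x. f x \<in> borel_measurable borel"
      and cont: "\<And>t. 0 \<le> t \<Longrightarrow> t \<le> 1 \<Longrightarrow> isCont (\<lambda>x. f x t) a"
      and bd: "\<And>x y. 1 \<le> x \<Longrightarrow> y \<in> space N \<Longrightarrow> \<bar>f x (T y)\<bar> \<le> 1" for f :: "real \<Rightarrow> real \<Rightarrow> real"
    unfolding tendsto_at_iff_sequentially comp_def
  proof (intro allI impI)
    fix X :: "nat \<Rightarrow> real" assume X: "\<forall>i. X i \<in> {1..} - {a}" "X \<longlonglongrightarrow> a"
    show "(\<lambda>i. \<integral>y. f (X i) (T y) \<partial>N) \<longlonglongrightarrow> (\<integral>y. f a (T y) \<partial>N)"
    proof (rule integral_dominated_convergence[where w = "\<lambda>_. 1"])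
      show "AE y in N. (\<lambda>i. f (X i) (T y)) \<longlonglongrightarrow> f a (T y)"
        using T_range by (intro AE_I2 isCont_tendsto_compose[OF cont X(2)]) auto
      show "AE y in N. norm (f (X i) (T y)) \<le> 1" for i
        using X(1) by (intro AE_I2) (simp add: bd)
    qed auto
  qed
  have "((\<lambda>x. mean x) \<longlongrightarrow> mean a) (at a within {1..})"
    unfolding mean_def using assms power_mean_le_one T_range power_mean_T_pos[THEN less_imp_le]
    by (intro lim isCont_power_mean) auto
  moreover have "((\<lambda>x. \<integral>y. power_mean x (T y) * power_slope x (T y) \<partial>N) \<longlongrightarrow>
      (\<integral>y. power_mean a (T y) * power_slope a (T y) \<partial>N)) (at a within {1..})"
    using assms weighted_slope_bound
    by (intro lim isCont_mult isCont_power_mean) auto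
  ultimately show ?thesis
    unfolding continuous_within mean_slope_def using mean_pos[OF assms] by (intro tendsto_divide) auto
qed

lemma ln_mean_has_derivative:
  assumes "1 \<le> a"
  shows "((\<lambda>a. ln (mean a)) has_field_derivative mean_slope a) (at a within {1..})"
  using assms mean_tangent continuous_mean_slope by (intro has_field_derivative_tangent) auto

text \<open>Slope 0 at 2 forces the posterior to be \<open>1 / 2\<close> almost everywhere, and then
  the slope at 1 is 0 too. Thus positive capacity entails a positive critical rate.\<close>

lemma mean_slope_two_neg:
  assumes "mean_slope 1 < 0"
  shows "mean_slope 2 < 0"
proof (rule ccontr)
  assume "\<not> mean_slope 2 < 0"
  then have "mean_slope 2 = 0" using mean_slope_nonpos[of 2] by simp
  then have "(\<integral>y. - (power_mean 2 (T y) * power_slope 2 (T y)) \<partial>N) = 0"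
    using mean_pos[of 2] by (simp add: mean_slope_def)
  then have "AE y in N. power_mean 2 (T y) * power_slope 2 (T y) = 0"
    using integrable_weighted_slope[of 2] power_mean_T_pos power_slope_bounds(2) T_range
    by (subst (asm) integral_nonneg_eq_0_iff_AE) (auto simp: mult_le_0_iff less_imp_le)
  then have "AE y in N. power_slope 1 (T y) = 0"
    using AE_space
  proof eventually_elim
    case (elim y)
    then have "power_slope 2 (T y) = 0" using power_mean_T_pos[of y 2] by auto
    then have "T y = 1 / 2" using power_slope_neg[of "T y" 2] T_range[of y] elim by fastforce
    moreover have "power_slope 1 (1 / 2) = 0"
      by (simp add: power_slope_def bin_entropy_def ln_div)
    ultimately show ?case by (simp only:)
  qed
  then have "mean_slope 1 = 0" unfolding mean_slope_one by (intro integral_eq_zero_AE) auto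
  then show False using assms by simp
qed

text \<open>
  If the tangent of \<open>ln mean\<close> at 1 meets the curve again at 2, both the pointwise tangent
  inequality and Jensen's inequality are equalities almost everywhere.
\<close>
lemma deterministic_if_linear:
  assumes eq: "ln (mean 2) = mean_slope 1" and neg: "mean_slope 1 < 0"
  shows "AE y in N. T y = 0 \<or> T y = 1"
proof -
  let ?F = "mean 2"
  \<comment> \<open>\<open>g\<close> is the gap in the pointwise tangent inequality and
    \<open>h\<close> the gap in \<open>ln x \<le> x - 1\<close> at the normalised power mean. Both
    are nonnegative, and under the hypothesis \<open>eq\<close> their integrals sum to 0.\<close>
  define g where "g y = ln (power_mean 2 (T y)) - power_slope 1 (T y)" for y
  define h where "h y = power_mean 2 (T y) / ?F - 1 - (ln (power_mean 2 (T y)) - ln ?F)" for y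
  have F: "0 < ?F" by (rule mean_pos) simp
  have g0: "0 \<le> g y" if "y \<in> space N" for y
    using power_mean_tangent[of "T y" 2 1] T_range[OF that] by (simp add: g_def)
  have h0: "0 \<le> h y" "h y = 0 \<Longrightarrow> power_mean 2 (T y) = ?F" if "y \<in> space N" for y
  proof -
    have x: "0 < power_mean 2 (T y) / ?F" using power_mean_T_pos[OF that] F by simp
    have l: "h y = power_mean 2 (T y) / ?F - 1 - ln (power_mean 2 (T y) / ?F)"
      using power_mean_T_pos[OF that, of 2] F by (simp add: h_def ln_div)
    show "0 \<le> h y" unfolding l using ln_le_minus_one[OF x] by simp
    show "power_mean 2 (T y) = ?F" if "h y = 0"
      using that ln_eq_minus_one[OF x] F unfolding l by simp
  qed
  have ln_bound: "\<bar>ln (power_mean 2 (T y))\<bar> \<le> ln 2" if y: "y \<in> space N" for y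
  proof -
    have "power_slope 1 (T y) \<le> ln (power_mean 2 (T y))" using g0[OF y] by (simp add: g_def)
    moreover have "ln (power_mean 2 (T y)) \<le> 0"
      using power_mean_le_one[of "T y" 2] power_mean_T_pos[OF y, of 2] T_range[OF y] by simp
    ultimately show ?thesis using power_slope_bounds[of "T y" 1] T_range[OF y] by simp
  qed
  have iln: "integrable N (\<lambda>y. ln (power_mean 2 (T y)))"
    using ln_bound by (intro integrable_const_bound[where B = "ln 2"]) auto
  note int = iln integrable_power_mean[of 2] integrable_power_slope[of 1]
  have ig: "integrable N g" and ih: "integrable N h" unfolding g_def h_def using int by auto
  have "(\<integral>y. g y \<partial>N) + (\<integral>y. h y \<partial>N) = ?F / ?F - 1 + ln ?F - mean_slope 1"
    unfolding g_def h_def using int by (simp add: mean_def[symmetric] mean_slope_one prob_space)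
  also have "\<dots> = 0" using F eq by simp
  finally have "(\<integral>y. g y \<partial>N) + (\<integral>y. h y \<partial>N) = 0" .
  moreover have "0 \<le> (\<integral>y. g y \<partial>N)" "0 \<le> (\<integral>y. h y \<partial>N)"
    using g0 h0(1) by (auto intro: Bochner_Integration.integral_nonneg)
  ultimately have "(\<integral>y. g y \<partial>N) = 0 \<and> (\<integral>y. h y \<partial>N) = 0" by linarith
  then have "AE y in N. g y = 0" "AE y in N. h y = 0"
    using integral_nonneg_eq_0_iff_AE[OF ig] integral_nonneg_eq_0_iff_AE[OF ih] g0 h0(1) by auto
  then show ?thesis
    using AE_space
  proof eventually_elim
    case (elim y)
    \<comment> \<open>At \<open>1 / 2\<close> the pointwise gap vanishes as well, so this value is
      excluded by \<open>h\<close>: it would give \<open>mean 2 = 1\<close>, against the negative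
      slope.\<close>
    have "T y \<noteq> 1 / 2"
    proof
      assume "T y = 1 / 2"
      then have "?F = power_mean 2 (1 / 2)" using h0(2)[of y] elim by (simp only:)
      then have "?F = 1" by (simp only: power_mean_two_half)
      then show False using eq neg by simp
    qed
    then show ?case
      using power_mean_two_strict[of "T y"] T_range[of y] elim by (fastforce simp: g_def)
  qed
qed

text \<open>The parameters are related by \<open>a = 1 + \<rho>\<close>, and \<open>K\<close> will
  be \<open>ln b\<close>. The bounds on \<open>ln mean\<close> turn around under the minus
  sign.\<close>

lemma exponent_function:
  assumes "0 < K" "mean_slope 1 < 0"
  shows "exponent_function (\<lambda>\<rho>. - ln (mean (1 + \<rho>)) / K) (- mean_slope 1 / K) (- mean_slope 2 / K)"
proof
  fix \<rho> :: real assume \<rho>: "0 \<le> \<rho>"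
  show "- ln (mean (1 + \<rho>)) / K \<le> - mean_slope 1 / K * \<rho>"
    using mean_tangent[of "1 + \<rho>" 1] \<rho> assms by (simp add: field_simps)
  show "- ln (mean (1 + \<rho>)) / K \<le> - ln (mean (1 + 1)) / K + - mean_slope 2 / K * (\<rho> - 1)"
    using mean_tangent[of "1 + \<rho>" 2] \<rho> assms by (simp add: field_simps)
next
  have "((\<lambda>a. ln (mean a)) has_field_derivative mean_slope 1) (at (1 + 0) within (+) 1 ` {0..})"
    using ln_mean_has_derivative[of 1] by simp
  then have "((\<lambda>a. ln (mean a)) \<circ> (+) 1 has_field_derivative mean_slope 1 * 1) (at 0 within {0..})"
    by (rule DERIV_image_chain) (auto intro!: derivative_eq_intros)
  then show "((\<lambda>\<rho>. - ln (mean (1 + \<rho>)) / K) has_field_derivative - mean_slope 1 / K) (at 0 within {0..})"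
    using DERIV_cdivide[OF DERIV_minus] by (fastforce simp: comp_def)
qed (use assms mean_slope_two_neg in \<open>auto simp: divide_neg_pos\<close>)

lemma deriv_exponent:
  "deriv (\<lambda>\<rho>. - ln (mean (1 + \<rho>)) / K) 1 = - mean_slope 2 / K"
proof (rule DERIV_imp_deriv)
  \<comment> \<open>Since 2 is an interior point, the derivative within the half-line is the
    ordinary one.\<close>
  have "at (2 :: real) within {1..} = at 2" by (rule at_within_interior) auto
  then have "((\<lambda>a. ln (mean a)) has_field_derivative mean_slope 2) (at (1 + 1))"
    using ln_mean_has_derivative[of 2] by simp
  then have "((\<lambda>\<rho>. ln (mean (\<rho> + 1))) has_field_derivative mean_slope 2) (at 1)"
    by (rule DERIV_shift[THEN iffD1])
  then have "((\<lambda>\<rho>. ln (mean (1 + \<rho>))) has_field_derivative mean_slope 2) (at 1)"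
    by (simp only: add.commute)
  then show "((\<lambda>\<rho>. - ln (mean (1 + \<rho>)) / K) has_field_derivative - mean_slope 2 / K) (at 1)"
    by (intro DERIV_cdivide DERIV_minus)
qed

end

subsection \<open>Binary-input channels\<close>

text \<open>For positive arguments this is convexity of the power. If one argument is 0, it reduces
  to \<open>c powr a \<le> c\<close> for \<open>c\<close> in the unit interval.\<close>

lemma powr_convex_combination:
  fixes u v \<theta> a :: real
  assumes "1 \<le> a" "0 \<le> \<theta>" "\<theta> \<le> 1" "0 \<le> u" "0 \<le> v"
  shows "((1 - \<theta>) * u + \<theta> * v) powr a \<le> (1 - \<theta>) * u powr a + \<theta> * v powr a"
proof -
  have scale: "(c * x) powr a \<le> c * x powr a" if "0 \<le> c" "c \<le> 1" "0 \<le> x" for c x :: real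
  proof (cases "c = 0")
    case False
    then have "c powr a \<le> c powr 1" using that assms by (intro powr_mono') auto
    then show ?thesis using that by (simp add: powr_mult mult_right_mono)
  qed simp
  consider "u = 0" | "v = 0" | "0 < u" "0 < v" using assms by linarith
  then show ?thesis
  proof cases
    case 3
    then show ?thesis
      using convex_onD[OF powr_convex[OF assms(1)], of \<theta> u v] assms by simp
  qed (use assms scale[of \<theta> v] scale[of "1 - \<theta>" u] in auto)
qed

lemma pmf_False_eq: "pmf Q False = 1 - pmf Q True"
proof -
  have "sum (pmf Q) UNIV = 1" by (rule sum_pmf_eq_1) auto
  then show ?thesis by (simp add: UNIV_bool)
qed

lemma pmf_unif_input [simp]: "pmf unif_input x = 1 / 2"
  by (cases x) auto

locale binary_channel =
  fixes M :: "'y measure" and W :: "bool \<Rightarrow> 'y \<Rightarrow> real"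
  assumes channel: "binary_input_channel M W"
begin

sublocale M: sigma_finite_measure M
  using channel by (simp add: binary_input_channel_def)

lemma W_measurable [measurable]: "W x \<in> borel_measurable M"
  and W_nonneg: "y \<in> space M \<Longrightarrow> 0 \<le> W x y"
  and W_total: "(\<integral>\<^sup>+ y. ennreal (W x y) \<partial>M) = 1"
  using channel by (auto simp: binary_input_channel_def)

lemma W_integrable: "integrable M (W x)"
  using W_total W_nonneg by (intro integrableI_nonneg) auto

lemma W_integral: "(\<integral>y. W x y \<partial>M) = 1"
  using W_total W_nonneg by (subst integral_eq_nn_integral) auto

definition out_density :: "'y \<Rightarrow> real" where
  "out_density y = (W False y + W True y) / 2"

text \<open>Where both likelihoods vanish, division by zero gives the value 0;
  \<open>out_density\<close> is 0 there, so products with it still recover the likelihoods.\<close>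

definition post :: "'y \<Rightarrow> real" where
  "post y = W False y / (W False y + W True y)"

definition out_law :: "'y measure" where
  "out_law = density M (\<lambda>y. ennreal (out_density y))"

lemma out_density_measurable [measurable]: "out_density \<in> borel_measurable M"
  and post_measurable [measurable]: "post \<in> borel_measurable M"
  unfolding out_density_def post_def by measurable

lemma out_density_nonneg: "y \<in> space M \<Longrightarrow> 0 \<le> out_density y"
  using W_nonneg by (simp add: out_density_def)

lemma W_conv_post:
  assumes "y \<in> space M"
  shows "W False y = 2 * out_density y * post y" "W True y = 2 * out_density y * (1 - post y)"
proof -
  consider "W False y = 0" "W True y = 0" | "W False y + W True y \<noteq> 0"
    using W_nonneg[OF assms, of True] W_nonneg[OF assms, of False] by linarith
  then have "W False y = 2 * out_density y * post y \<and> W True y = 2 * out_density y * (1 - post y)"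
  proof cases
    case 2
    then have "1 - post y = W True y / (W False y + W True y)" by (simp add: post_def field_simps)
    moreover have "2 * out_density y = W False y + W True y" by (simp add: out_density_def)
    ultimately show ?thesis using 2 by (simp add: post_def)
  qed (simp add: out_density_def)
  then show "W False y = 2 * out_density y * post y" "W True y = 2 * out_density y * (1 - post y)"
    by auto
qed

lemma out_density_total: "(\<integral>\<^sup>+ y. ennreal (out_density y) \<partial>M) = 1"
proof -
  have "(\<integral>y. out_density y \<partial>M) = 1" "integrable M out_density"
    unfolding out_density_def[abs_def] using W_integrable by (simp_all add: W_integral)
  then show ?thesis
    using out_density_nonneg by (subst nn_integral_eq_integral) auto
qed

lemma W_half_total: "(\<integral>\<^sup>+ y. ennreal (W x y / 2) \<partial>M) = ennreal (1 / 2)"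
  using W_integrable[of x] W_nonneg by (subst nn_integral_eq_integral) (auto simp: W_integral)

sublocale posterior out_law post
proof (intro posterior.intro posterior_axioms.intro)
  show "prob_space out_law"
    unfolding out_law_def using out_density_total
    by (intro prob_spaceI) (simp add: emeasure_density cong: nn_integral_cong)
  show "post \<in> borel_measurable out_law" by (simp add: out_law_def)
  show "0 \<le> post y" "post y \<le> 1" if "y \<in> space out_law" for y
    using that W_nonneg[of y True] W_nonneg[of y False] unfolding post_def out_law_def
    by (auto simp: divide_le_eq_1)
qed

lemma integral_out_law:
  "f \<in> borel_measurable M \<Longrightarrow> (\<integral>y. f y \<partial>out_law) = (\<integral>y. out_density y * f y \<partial>M)"
  for f :: "'y \<Rightarrow> real"
  unfolding out_law_def using out_density_nonneg by (subst integral_density) auto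

lemma integrable_out_law:
  "f \<in> borel_measurable M \<Longrightarrow> integrable out_law f \<longleftrightarrow> integrable M (\<lambda>y. out_density y * f y)"
  for f :: "'y \<Rightarrow> real"
  unfolding out_law_def using out_density_nonneg by (subst integrable_density) auto

lemma post_range:
  assumes "y \<in> space M"
  shows "0 \<le> post y" "post y \<le> 1"
  using T_range assms by (auto simp: out_law_def)

text \<open>With \<open>s = 2 * out_density y\<close>, a factor \<open>s powr (1 / a)\<close> leaves
  the inner sum and becomes \<open>s\<close> under the outer power; its 2 is the factor in
  \<open>power_mean\<close>.\<close>

lemma gallager_integral:
  assumes "a \<noteq> 0"
  shows "(\<integral>y. (\<Sum>x\<in>UNIV. pmf unif_input x * W x y powr (1 / a)) powr a \<partial>M) = mean a"
  unfolding mean_def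
proof (subst integral_out_law, measurable, intro Bochner_Integration.integral_cong refl)
  fix y assume y: "y \<in> space M"
  let ?s = "2 * out_density y"
  have s: "0 \<le> ?s" using out_density_nonneg[OF y] by simp
  have "(\<Sum>x\<in>UNIV. pmf unif_input x * W x y powr (1 / a)) =
      (?s * post y) powr (1 / a) / 2 + (?s * (1 - post y)) powr (1 / a) / 2"
    by (simp add: UNIV_bool W_conv_post[OF y])
  also have "\<dots> = ?s powr (1 / a) * (tilt_sum a (post y) / 2)"
    using s post_range[OF y] by (simp only: powr_mult tilt_sum_def) (simp add: field_simps)
  finally have sum_eq: "(\<Sum>x\<in>UNIV. pmf unif_input x * W x y powr (1 / a)) =
      ?s powr (1 / a) * (tilt_sum a (post y) / 2)" .
  have "(\<Sum>x\<in>UNIV. pmf unif_input x * W x y powr (1 / a)) powr a =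
      (?s powr (1 / a)) powr a * (tilt_sum a (post y) / 2) powr a"
    unfolding sum_eq by (rule powr_mult)
  also have "(?s powr (1 / a)) powr a = ?s" using s assms by (simp add: powr_powr)
  finally show "(\<Sum>x\<in>UNIV. pmf unif_input x * W x y powr (1 / a)) powr a =
      out_density y * power_mean a (post y)"
    by (simp add: power_mean_def)
qed

lemma gallager_E0_unif:
  assumes "1 < b" "\<rho> \<noteq> - 1"
  shows "gallager_E0 b M W \<rho> unif_input = - ln (mean (1 + \<rho>)) / ln b"
  using gallager_integral[of "1 + \<rho>"] assms by (simp add: gallager_E0_def log_def)

lemma critical_rate_eq:
  assumes "1 < b"
  shows "critical_rate b M W = - mean_slope 2 / ln b"
proof -
  \<comment> \<open>A derivative depends only on values near the point, so the formula is needed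
    merely on a neighbourhood of 1.\<close>
  have "eventually (\<lambda>\<rho>::real. \<rho> > - 1) (nhds 1)" using eventually_nhds_in_open[of "{- 1<..}" "1 :: real"] by simp
  then have "eventually (\<lambda>\<rho>. gallager_E0 b M W \<rho> unif_input = - ln (mean (1 + \<rho>)) / ln b) (nhds 1)"
    by eventually_elim (rule gallager_E0_unif[OF assms], auto)
  then show ?thesis
    unfolding critical_rate_def deriv_exponent[of "ln b", symmetric] by (rule deriv_cong_ev) simp
qed

lemma prob_space_joint_law: "prob_space (joint_law M W unif_input)"
proof (rule prob_spaceI)
  have "emeasure (joint_law M W unif_input) (space (joint_law M W unif_input)) =
      (\<integral>\<^sup>+ z. (case z of (x, y) \<Rightarrow> ennreal (1 / 2 * W x y)) \<partial>(count_space UNIV \<Otimes>\<^sub>M M))"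
    unfolding joint_law_def
    by (simp add: emeasure_density measurable_pair_measure_countable1 cong: nn_integral_cong)
  also have "\<dots> = (\<integral>\<^sup>+ x. (\<integral>\<^sup>+ y. ennreal (W x y / 2) \<partial>M) \<partial>count_space UNIV)"
    by (subst M.nn_integral_fst[symmetric]) (auto intro!: measurable_pair_measure_countable1)
  also have "\<dots> = (\<Sum>x\<in>(UNIV :: bool set). ennreal (1 / 2))"
    unfolding W_half_total by (rule nn_integral_count_space_finite) simp
  also have "\<dots> = 1" by (subst sum_ennreal) (auto simp: UNIV_bool)
  finally show "emeasure (joint_law M W unif_input) (space (joint_law M W unif_input)) = 1" .
qed

text \<open>Relative to the product of its marginals, the joint law has density twice the posterior
  of the input. The mean of its logarithm is that of \<open>ln 2 - bin_entropy (post y)\<close>, in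
  units of \<open>ln b\<close>.\<close>

lemma mutual_info_eq:
  assumes "1 < b"
  shows "mutual_info b M W unif_input = - mean_slope 1 / ln b"
proof -
  let ?S = "count_space (UNIV :: bool set)"
  let ?J = "joint_law M W unif_input"
  let ?P = "\<lambda>z :: bool \<times> 'y. W (fst z) (snd z) / 2"
  let ?f = "\<lambda>z. ?P z * log b (?P z / (1 / 2 * out_density (snd z)))"
  interpret J: prob_space ?J by (rule prob_space_joint_law)
  interpret J: information_space ?J b by standard (rule assms)
  interpret S: sigma_finite_measure ?S by (rule sigma_finite_measure_count_space_finite) simp
  interpret SM: pair_sigma_finite ?S M ..
  have P_meas [measurable]: "?P \<in> borel_measurable (?S \<Otimes>\<^sub>M M)"
    by (rule measurable_pair_measure_countable1) auto
  have P_pair: "distributed ?J (?S \<Otimes>\<^sub>M M) (\<lambda>z. (fst z, snd z)) ?P"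
  proof -
    have "distr ?J (?S \<Otimes>\<^sub>M M) (\<lambda>z. z) = ?J"
      by (rule distr_id2) (simp add: joint_law_def)
    then show ?thesis
      by (auto simp: distributed_def joint_law_def case_prod_beta')
  qed
  have P_in: "distributed ?J ?S fst (\<lambda>_. ennreal (1 / 2))"
    using J.distr_marginal1[OF S.sigma_finite_measure_axioms M.sigma_finite_measure_axioms P_pair]
      W_half_total by simp
  have "distributed ?J M snd (\<lambda>y. \<integral>\<^sup>+ x. ennreal (W x y / 2) \<partial>?S)"
    using J.distr_marginal2[OF S.sigma_finite_measure_axioms M.sigma_finite_measure_axioms P_pair] by simp
  moreover have "(\<integral>\<^sup>+ x. ennreal (W x y / 2) \<partial>?S) = ennreal (out_density y)" if "y \<in> space M" for y
    using W_nonneg[OF that]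
    by (simp add: nn_integral_count_space_finite UNIV_bool out_density_def add_divide_distrib)
  ultimately have P_out: "distributed ?J M snd (\<lambda>y. ennreal (out_density y))"
    by (subst (asm) distributed_cong_density[where g = "\<lambda>y. ennreal (out_density y)"]) auto
  have f_meas: "?f \<in> borel_measurable (?S \<Otimes>\<^sub>M M)" by measurable
  have mi: "mutual_info b M W unif_input = integral\<^sup>L (?S \<Otimes>\<^sub>M M) ?f"
    unfolding mutual_info_def using out_density_nonneg W_nonneg
    by (intro J.mutual_information_distr[OF S.sigma_finite_measure_axioms M.sigma_finite_measure_axioms
        P_in _ P_out _ P_pair]) auto
  \<comment> \<open>The posterior probability of input \<open>x\<close> given output
    \<open>y\<close>.\<close>
  define q where "q x y = (if x then 1 - post y else post y)" for x :: bool and y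
  have f_eq: "?f (x, y) = out_density y * (q x y * (ln 2 + ln (q x y))) / ln b" if y: "y \<in> space M" for x y
  proof -
    have "W x y = 2 * out_density y * q x y" using W_conv_post[OF y] by (simp add: q_def)
    moreover have "ln (2 * q x y) = ln 2 + ln (q x y)" if "q x y \<noteq> 0"
      using that post_range[OF y] by (auto simp: ln_mult q_def)
    ultimately show ?thesis
      by (cases "q x y = 0 \<or> out_density y = 0") (auto simp: log_def field_simps)
  qed
  have q_meas [measurable]: "q x \<in> borel_measurable M" for x unfolding q_def by (cases x) auto
  \<comment> \<open>Boundedness gives the integrability needed for Fubini; the lower bound comes
    from \<open>- q * ln q \<le> 1 - q\<close>.\<close>
  have q_bound: "\<bar>q x y * (ln 2 + ln (q x y))\<bar> \<le> 1" if y: "y \<in> space M" for x y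
  proof (cases "q x y = 0")
    case False
    then have q: "0 < q x y" "q x y \<le> 1" using post_range[OF y] by (auto simp: q_def)
    have "q x y * (ln 2 + ln (q x y)) \<le> q x y * ln 2" using q by (intro mult_left_mono) auto
    also have "\<dots> \<le> 1 * ln 2" using q by (intro mult_right_mono) auto
    finally have 1: "q x y * (ln 2 + ln (q x y)) \<le> 1 * ln 2" .
    have "ln (1 / q x y) \<le> 1 / q x y - 1" using q by (intro ln_le_minus_one) auto
    then have "q x y * (- ln (q x y)) \<le> q x y * (1 / q x y - 1)"
      using q by (intro mult_left_mono) (simp_all add: ln_div)
    then have "- (q x y * ln (q x y)) \<le> 1 - q x y" using q by (simp add: right_diff_distrib)
    moreover have "0 \<le> q x y * ln 2" using q by simp
    ultimately show ?thesis
      using 1 q ln_le_minus_one[of 2] unfolding abs_le_iff distrib_left by linarith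
  qed simp
  have q_int: "integrable out_law (\<lambda>y. q x y * (ln 2 + ln (q x y)))" for x
    using q_bound by (intro integrable_const_bound[where B = 1]) (auto simp: out_law_def)
  then have f_int: "integrable M (\<lambda>y. ?f (x, y))" for x
    using f_eq by (subst Bochner_Integration.integrable_cong[OF refl f_eq]) (auto simp: integrable_out_law)
  have f_val: "(\<integral>y. ?f (x, y) \<partial>M) = (\<integral>y. q x y * (ln 2 + ln (q x y)) \<partial>out_law) / ln b" for x
    using f_eq by (subst Bochner_Integration.integral_cong[OF refl f_eq]) (auto simp: integral_out_law)
  have "integrable (?S \<Otimes>\<^sub>M M) ?f"
    using f_int by (intro SM.Fubini_integrable f_meas)
      (auto intro: integrable_count_space)
  then have "integral\<^sup>L (?S \<Otimes>\<^sub>M M) ?f = (\<integral>x. \<integral>y. ?f (x, y) \<partial>M \<partial>?S)"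
    by (rule SM.integral_fst'[symmetric])
  also have "\<dots> = (\<Sum>x\<in>UNIV. \<integral>y. ?f (x, y) \<partial>M)"
    by (rule lebesgue_integral_count_space_finite) simp
  also have "\<dots> = (\<integral>y. q False y * (ln 2 + ln (q False y)) + q True y * (ln 2 + ln (q True y)) \<partial>out_law) / ln b"
    unfolding f_val using q_int by (simp add: UNIV_bool add_divide_distrib)
  also have "(\<integral>y. q False y * (ln 2 + ln (q False y)) + q True y * (ln 2 + ln (q True y)) \<partial>out_law) =
      (\<integral>y. - power_slope 1 (post y) \<partial>out_law)"
    using T_range by (intro Bochner_Integration.integral_cong)
      (auto simp: q_def power_slope_def bin_entropy_def algebra_simps)
  finally show ?thesis by (simp add: mi mean_slope_one)
qed

text \<open>A posterior of 0 or 1 means that one likelihood vanishes; outside the support of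
  \<open>out_density\<close> both do.\<close>

lemma noiseless_if_linear:
  assumes "ln (mean 2) = mean_slope 1" "mean_slope 1 < 0"
  shows "noiseless M W"
proof -
  have "AE y in M. 0 < out_density y \<longrightarrow> post y = 0 \<or> post y = 1"
    using deterministic_if_linear[OF assms] unfolding out_law_def by (subst (asm) AE_density) auto
  then show ?thesis
    unfolding noiseless_def using AE_space
  proof eventually_elim
    case (elim y)
    then show ?case
      using W_conv_post[of y] out_density_nonneg[of y] by (cases "out_density y = 0") auto
  qed
qed

text \<open>
  By the involution, an input distribution and its reversal have the same exponent, and
  their average is the uniform distribution.
\<close>
lemma gallager_E0_le_unif:
  assumes "1 < b" "0 \<le> \<rho>" "output_symmetric M W"
  shows "gallager_E0 b M W \<rho> Q \<le> gallager_E0 b M W \<rho> unif_input"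
proof -
  define a where "a = 1 + \<rho>"
  have a: "1 \<le> a" using assms by (simp add: a_def)
  obtain \<pi> where [measurable]: "\<pi> \<in> measurable M M" and distr: "distr M M \<pi> = M"
    and invol: "\<And>y. y \<in> space M \<Longrightarrow> \<pi> (\<pi> y) = y"
    and swap: "\<And>y. y \<in> space M \<Longrightarrow> W False y = W True (\<pi> y)"
    using assms(3) by (auto simp: output_symmetric_def)
  \<comment> \<open>Gallager's integrand for the input distribution that gives \<open>True\<close>
    probability \<open>q\<close>.\<close>
  define G where "G q y = ((1 - q) * W False y powr (1 / a) + q * W True y powr (1 / a)) powr a" for q y
  let ?q = "pmf Q True"
  have q: "0 \<le> ?q" "?q \<le> 1" by (auto simp: pmf_le_1)
  have [measurable]: "G q \<in> borel_measurable M" for q unfolding G_def by measurable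
  have G_int: "integrable M (G q)" if "0 \<le> q" "q \<le> 1" for q
  proof (rule Bochner_Integration.integrable_bound[where f = "\<lambda>y. (1 - q) * W False y + q * W True y"])
    show "AE y in M. norm (G q y) \<le> norm ((1 - q) * W False y + q * W True y)"
    proof (rule AE_I2)
      fix y assume y: "y \<in> space M"
      have "G q y \<le> (1 - q) * (W False y powr (1 / a)) powr a + q * (W True y powr (1 / a)) powr a"
        unfolding G_def using that a by (intro powr_convex_combination) auto
      then show "norm (G q y) \<le> norm ((1 - q) * W False y + q * W True y)"
        using W_nonneg[OF y] a by (simp add: powr_powr G_def)
    qed
  qed (use W_integrable in auto)
  \<comment> \<open>The change of variables along the involution exchanges the two likelihoods,
    which amounts to replacing \<open>q\<close> by \<open>1 - q\<close>.\<close>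
  have "(\<integral>y. G ?q y \<partial>M) = (\<integral>y. G ?q y \<partial>distr M M \<pi>)" by (simp add: distr)
  also have "\<dots> = (\<integral>y. G ?q (\<pi> y) \<partial>M)" by (rule integral_distr) auto
  also have "\<dots> = (\<integral>y. G (1 - ?q) y \<partial>M)"
  proof (rule Bochner_Integration.integral_cong[OF refl])
    fix y assume y: "y \<in> space M"
    have "\<pi> y \<in> space M" using y by (rule measurable_space[rotated]) simp
    then have "W False (\<pi> y) = W True y" using swap[of "\<pi> y"] invol[OF y] by simp
    then show "G ?q (\<pi> y) = G (1 - ?q) y" using swap[OF y] by (simp add: G_def add.commute)
  qed
  finally have rev: "(\<integral>y. G ?q y \<partial>M) = (\<integral>y. G (1 - ?q) y \<partial>M)" .
  have "mean a = (\<integral>y. G (1 / 2) y \<partial>M)"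
    using gallager_integral[of a] a by (simp add: G_def UNIV_bool)
  also have "\<dots> \<le> (\<integral>y. (1 - 1 / 2) * G ?q y + 1 / 2 * G (1 - ?q) y \<partial>M)"
  proof (rule integral_mono)
    fix y assume y: "y \<in> space M"
    \<comment> \<open>The inner sum for the uniform input is the midpoint of those for
      \<open>q\<close> and \<open>1 - q\<close>, so convexity of the power applies.\<close>
    let ?u = "\<lambda>q. (1 - q) * W False y powr (1 / a) + q * W True y powr (1 / a)"
    have "((1 - 1 / 2) * ?u ?q + 1 / 2 * ?u (1 - ?q)) powr a \<le>
        (1 - 1 / 2) * ?u ?q powr a + 1 / 2 * ?u (1 - ?q) powr a"
      using q by (intro powr_convex_combination a) auto
    moreover have "(1 - 1 / 2) * ?u ?q + 1 / 2 * ?u (1 - ?q) = ?u (1 / 2)"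
      by (simp add: field_simps)
    ultimately show "G (1 / 2) y \<le> (1 - 1 / 2) * G ?q y + 1 / 2 * G (1 - ?q) y"
      by (simp only: G_def)
  qed (use G_int q in auto)
  also have "\<dots> = (\<integral>y. G ?q y \<partial>M)"
    using G_int[of ?q] G_int[of "1 - ?q"] q by (simp add: rev)
  finally have "mean a \<le> (\<integral>y. G ?q y \<partial>M)" .
  then have "log b (mean a) \<le> log b (\<integral>y. G ?q y \<partial>M)"
    using mean_pos[OF a] assms(1) by simp
  then show ?thesis
    using gallager_E0_unif[OF assms(1), of \<rho>] assms
    by (simp add: gallager_E0_def UNIV_bool pmf_False_eq[of Q] G_def a_def log_def)
qed

lemma sphere_packing_exponent_eq:
  assumes "1 < b" "output_symmetric M W"
  shows "sphere_packing_exponent b M W r =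
    (SUP \<rho>\<in>{0..}. ereal (- ln (mean (1 + \<rho>)) / ln b - \<rho> * r))"
  unfolding sphere_packing_exponent_def
proof (intro SUP_cong refl)
  fix \<rho> :: real assume \<rho>: "\<rho> \<in> {0..}"
  have "(SUP Q. ereal (gallager_E0 b M W \<rho> Q)) = ereal (gallager_E0 b M W \<rho> unif_input)"
    using gallager_E0_le_unif[OF assms(1) _ assms(2), of \<rho>] \<rho>
    by (intro antisym SUP_least SUP_upper) auto
  then show "(SUP Q. ereal (gallager_E0 b M W \<rho> Q)) - ereal (\<rho> * r) =
      ereal (- ln (mean (1 + \<rho>)) / ln b - \<rho> * r)"
    using gallager_E0_unif[OF assms(1), of \<rho>] \<rho> by simp
qed

end

(* If W is noiseless, then gallager_E0 is linear in rho for the uniform input and the critical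
   ratio equals 1; so the upper bound 1 on the ratio is strict only for the other channels, and
   the value at the ratio itself is only considered when the ratio is below 1. *)
theorem theorem18:
  fixes b :: real and M :: "'y measure" and W :: "bool \<Rightarrow> 'y \<Rightarrow> real"
  assumes "1 < b"
    and "binary_input_channel M W"
    and "output_symmetric M W"
    and "0 < mutual_info b M W unif_input"
  shows
    "0 < critical_ratio b M W \<and> critical_ratio b M W \<le> 1 \<and>
     (\<not> noiseless M W \<longrightarrow> critical_ratio b M W < 1) \<and>
     (\<forall>\<alpha>\<in>{0<..<1}. \<exists>!r. is_rate_alpha b M W unif_input \<alpha> r) \<and>
     (\<forall>\<alpha>\<in>{0<..<1}. \<alpha> \<le> critical_ratio b M W \<longrightarrow>
        rate_alpha b M W unif_input \<alpha> = \<alpha> * cutoff_rate b M W) \<and>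
     (\<forall>\<alpha>\<in>{critical_ratio b M W<..<1}.
        rate_alpha b M W unif_input \<alpha> \<in> {critical_rate b M W<..<capacity b M W} \<and>
        (\<forall>r. sphere_packing_exponent b M W r = ereal ((1 / \<alpha> - 1) * r) \<longleftrightarrow>
             r = rate_alpha b M W unif_input \<alpha>)) \<and>
     continuous_on {critical_ratio b M W..<1} (rate_alpha b M W unif_input) \<and>
     strict_mono_on {critical_ratio b M W..<1} (rate_alpha b M W unif_input) \<and>
     (critical_ratio b M W < 1 \<longrightarrow>
        rate_alpha b M W unif_input (critical_ratio b M W) = critical_rate b M W) \<and>
     (rate_alpha b M W unif_input \<longlongrightarrow> capacity b M W) (at_left 1)"
proof -
  interpret binary_channel M W by standard fact
  have b: "0 < ln b" using assms(1) by simp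
  have neg: "mean_slope 1 < 0"
    using assms(4) mutual_info_eq[OF assms(1)] b by (simp add: divide_less_0_iff)
  define E where "E = (\<lambda>\<rho>. - ln (mean (1 + \<rho>)) / ln b)"
  interpret X: exponent_function E "- mean_slope 1 / ln b" "- mean_slope 2 / ln b"
    unfolding E_def by (rule exponent_function[OF b neg])
  let ?C = "- mean_slope 1 / ln b" and ?Rc = "critical_rate b M W" and ?ac = "critical_ratio b M W"
  have Rc: "- mean_slope 2 / ln b = ?Rc" using critical_rate_eq[OF assms(1)] by simp
  have E_eq: "gallager_E0 b M W \<rho> unif_input = E \<rho>" if "\<rho> \<noteq> - 1" for \<rho>
    unfolding E_def using gallager_E0_unif[OF assms(1) that] .
  have R0: "cutoff_rate b M W = E 1" by (simp add: cutoff_rate_def E_eq)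
  have ac: "?ac = ?Rc / E 1" by (simp add: critical_ratio_def R0)
  have expo: "random_coding_exponent b M W unif_input r = X.expo r" for r
    unfolding random_coding_exponent_def X.expo_def by (intro SUP_cong refl) (simp add: E_eq)
  have is_rate: "is_rate_alpha b M W unif_input \<alpha> r \<longleftrightarrow> X.is_rate \<alpha> r" for \<alpha> r
    by (simp only: is_rate_alpha_def X.is_rate_def mutual_info_eq[OF assms(1)] expo)
  have rate: "rate_alpha b M W unif_input = X.rate"
    by (rule ext) (simp only: rate_alpha_def X.rate_def is_rate)
  have C: "capacity b M W = ?C" by (simp add: capacity_def mutual_info_eq[OF assms(1)])
  note facts = X.Rc_pos X.Rc_le X.E_one_pos
  have ac_pos: "0 < ?ac" using facts Rc ac by simp
  \<comment> \<open>This interval is empty when the critical ratio is 1.\<close>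
  have sub: "{?ac..<1} \<subseteq> {0<..<1}" using ac_pos by auto
  have ac_less: "?ac < 1" if "\<not> noiseless M W"
  proof -
    \<comment> \<open>If \<open>E 1\<close> were the capacity, the tangent at 0 would meet the curve
      again at \<open>\<rho> = 1\<close>, which happens only for noiseless channels.\<close>
    have "ln (mean 2) \<noteq> mean_slope 1" using noiseless_if_linear neg that by blast
    then have "E 1 \<noteq> ?C" using b by (simp add: E_def)
    then have "- mean_slope 2 / ln b < E 1" using X.C_ge by (intro X.Rc_less) simp
    then show ?thesis using facts Rc ac by simp
  qed
  have above: "X.rate \<alpha> \<in> {?Rc<..<?C}"
    "(\<forall>r. sphere_packing_exponent b M W r = ereal ((1 / \<alpha> - 1) * r) \<longleftrightarrow> r = X.rate \<alpha>)"
    if "\<alpha> \<in> {?ac<..<1}" for \<alpha>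
  proof -
    have \<alpha>: "\<alpha> \<in> {0<..<1}" "- mean_slope 2 / ln b / E 1 < \<alpha>" using that ac_pos ac Rc by auto
    show "X.rate \<alpha> \<in> {?Rc<..<?C}"
      using X.rate_above_critical[OF \<alpha>] X.rate_range[OF \<alpha>(1)] Rc by simp
    show "\<forall>r. sphere_packing_exponent b M W r = ereal ((1 / \<alpha> - 1) * r) \<longleftrightarrow> r = X.rate \<alpha>"
      using X.SUP_eq_iff_rate[OF \<alpha>] sphere_packing_exponent_eq[OF assms(1,3)] by (simp add: E_def)
  qed
  have below: "X.rate \<alpha> = \<alpha> * E 1" if "\<alpha> \<in> {0<..<1}" "\<alpha> \<le> ?ac" for \<alpha>
    using X.rate_below_critical[of \<alpha>] that unfolding ac Rc by blast
  have "X.rate ?ac = ?Rc" if "?ac < 1"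
    using below[of ?ac] that ac_pos ac facts by simp
  moreover have "?ac \<le> 1" using facts Rc ac by simp
  ultimately show ?thesis
    unfolding rate is_rate C R0
    using ac_pos ac_less X.ex1_rate below above continuous_on_subset[OF X.continuous_on_rate sub]
      monotone_on_subset[OF X.strict_mono_on_rate sub] X.rate_tendsto
    by blast
qed

end
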